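(* Let $p$ be a prime and let $A \subset \mathbb{Z}_p$ satisfy $|2A| \leq 2.48|A| - 7$ and $|A| < p/10^{10}$. Then there is an arithmetic progression $P \subset \mathbb{Z}_p$ such that $A \subset P$ and $|P| \leq |2A| - |A| + 1$.
   Context: For a subset $A$ of an abelian group, $2A = A + A = \{a + a' : a, a' \in A\}$ denotes its sumset. An arithmetic progression in $\mathbb{Z}_p$ is a set of the form $\{x, x+r, \dots, x+(k-1)r\}$ with $r \neq 0$. *)

theory Defs
  imports Complex_Main "HOL-Number_Theory.Residues"
begin

definition arithmetic_progression :: "('a, 'b) ring_scheme \<Rightarrow> 'a set \<Rightarrow> bool" where
  "arithmetic_progression R P \<longleftrightarrow>
     (\<exists>x \<in> carrier R. \<exists>r \<in> carrier R. \<exists>k::nat. r \<noteq> \<zero>\<^bsub>R\<^esub> \<and> 1 \<le> k \<and>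
        P = (\<lambda>i::nat. x \<oplus>\<^bsub>R\<^esub> [i] \<cdot>\<^bsub>R\<^esub> r) ` {0..k - 1})"

end

theory Submission
  imports Defs "HOL-Library.Set_Algebras" "HOL-Analysis.Analysis"
begin

text \<open>Let \<open>|2A| = K |A|\<close>. Counting the solutions of \<open>a + c = a' + c'\<close> with \<open>a, a' \<in> A\<close> and
  \<open>c, c' \<in> 2A\<close> both by Parseval's identity and by the Katz-Koester inclusion, as Lev and Shkredov do,
  gives a nontrivial Fourier coefficient of \<open>A\<close> of size about \<open>|A| \<surd>(1/K + 1/K\<^sup>2) \<ge> 3/4 |A|\<close>. By
  Freiman's half circle lemma a dilate of \<open>A\<close> has 7/8 of its elements in a half circle, and these form
  a set of integers with doubling below 3, which lies in an arithmetic progression of length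
  \<open>O(|A|)\<close>. As \<open>A\<close> is sparse, every element of \<open>A\<close> must lie near this progression, so that all of
  \<open>A\<close> is equivalent to a set of integers; its doubling is less than \<open>5/2\<close>, and reducing it modulo its
  length \<open>l\<close>, where sets with doubling below \<open>3/2\<close> generate a coset of a subgroup, yields
  \<open>l \<le> |2A| - |A|\<close>.\<close>

section \<open>Counting residues\<close>

text \<open>Cauchy-Davenport type growth is drawn from a submodular function whose coefficient is
  0.99, never 1. With 1, the whole group would have the value 0, which is always minimal, and the
  argument would be empty. A coefficient \<open>K < 1\<close> charges the whole group
  \<open>1 - K\<close> times its order. Modulo p, sparsity makes this charge too high; modulo the
  length l of a set of integers, the charge is itself the bound on l, and 0.01 l <= 0.845 |A| is the
  origin of the factor 85 below. The price is a loss of 0.01 per element, harmless for a handful of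
  cosets and absorbed by the slack in the Fourier estimate.\<close>

definition nres :: "int \<Rightarrow> int set \<Rightarrow> nat" where
  "nres m X = card ((\<lambda>x. x mod m) ` X)"

text \<open>Sets of residues are encoded as sets of integers, so that one set can be read modulo p,
  modulo its length, modulo a divisor of that, and in the integers. Adding \<open>mults g\<close>
  replaces a set by the union of the cosets of the subgroup generated by \<open>g\<close> that it
  meets.\<close>

definition mults :: "int \<Rightarrow> int set" where
  "mults g = {x. g dvd x}"

lemma finite_residues: "0 < (m::int) \<Longrightarrow> finite ((\<lambda>x. x mod m) ` X)"
  by (rule finite_subset[of _ "{0..<m}"]) auto

lemma nres_mono: "0 < m \<Longrightarrow> X \<subseteq> Y \<Longrightarrow> nres m X \<le> nres m Y"
  unfolding nres_def by (intro card_mono finite_residues image_mono)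

lemma nres_le: "0 < m \<Longrightarrow> nres m X \<le> nat m"
proof -
  assume "0 < m"
  then have "nres m X \<le> card {0..<m}"
    unfolding nres_def by (intro card_mono) auto
  then show ?thesis by simp
qed

lemma nres_le_card: "finite X \<Longrightarrow> nres m X \<le> card X"
  unfolding nres_def by (rule card_image_le)

lemma nres_pos: "0 < m \<Longrightarrow> X \<noteq> {} \<Longrightarrow> 0 < nres m X"
  unfolding nres_def by (simp add: card_gt_0_iff finite_residues)

lemma nres_eq_card: "X \<subseteq> {0..<m} \<Longrightarrow> nres m X = card X"
proof -
  assume "X \<subseteq> {0..<m}"
  then have "(\<lambda>x. x mod m) ` X = X" by (force simp: subset_iff image_iff)
  then show ?thesis by (simp add: nres_def)
qed


lemma nres_image_eq:
  assumes "\<And>x y. x \<in> X \<Longrightarrow> y \<in> X \<Longrightarrow> h x mod m = h y mod m \<longleftrightarrow> x mod m = y mod m"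
  shows "nres m (h ` X) = nres m X"
proof -
  define \<phi> where "\<phi> r = h (SOME x. x \<in> X \<and> x mod m = r) mod m" for r
  have \<phi>: "\<phi> (x mod m) = h x mod m" if "x \<in> X" for x
  proof -
    have "(SOME y. y \<in> X \<and> y mod m = x mod m) \<in> X \<and> (SOME y. y \<in> X \<and> y mod m = x mod m) mod m = x mod m"
      by (rule someI[of "\<lambda>y. y \<in> X \<and> y mod m = x mod m" x]) (use that in simp)
    then show ?thesis unfolding \<phi>_def using assms that by blast
  qed
  have "bij_betw \<phi> ((\<lambda>x. x mod m) ` X) ((\<lambda>x. x mod m) ` h ` X)"
  proof (rule bij_betw_imageI)
    show "inj_on \<phi> ((\<lambda>x. x mod m) ` X)"
      using assms \<phi> by (auto intro!: inj_onI)
    show "\<phi> ` (\<lambda>x. x mod m) ` X = (\<lambda>x. x mod m) ` h ` X"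
      using \<phi> by (force simp: image_iff)
  qed
  then show ?thesis unfolding nres_def using bij_betw_same_card by metis
qed

lemma nres_translate: "nres m ((\<lambda>x. t + x) ` X) = nres m X"
  by (rule nres_image_eq) (simp add: mod_eq_dvd_iff)

lemma subset_plus_mults: "X \<subseteq> X + mults g"
proof
  fix x assume "x \<in> X"
  then have "x + 0 \<in> X + mults g" by (intro set_plus_intro) (auto simp: mults_def)
  then show "x \<in> X + mults g" by simp
qed

lemma set_plus_mults_self:
  assumes "g dvd m" shows "mults g + mults m = mults g"
proof
  show "mults g + mults m \<subseteq> mults g"
    using assms by (auto simp: mults_def set_plus_def intro: dvd_trans)
  show "mults g \<subseteq> mults g + mults m"
    by (rule subset_plus_mults)
qed

text \<open>Each residue modulo \<open>g\<close> has \<open>m div g\<close> lifts modulo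
  \<open>m\<close>. This turns counts of unions of cosets modulo \<open>m\<close> into counts modulo
  \<open>g\<close>.\<close>

lemma nres_plus_mults:
  assumes "0 < m" "0 < g" "g dvd m"
  shows "nres m (X + mults g) = nres g X * nat (m div g)"
proof -
  define q where "q = m div g"
  have m: "m = g * q" and q: "0 < q" 
    using assms by (auto simp: q_def pos_imp_zdiv_pos_iff zdvd_imp_le)
  let ?f = "\<lambda>(r, i). r + g * i"
  have "bij_betw ?f ((\<lambda>x. x mod g) ` X \<times> {0..<q}) ((\<lambda>x. x mod m) ` (X + mults g))"
  proof (rule bij_betw_imageI)
    show "inj_on ?f ((\<lambda>x. x mod g) ` X \<times> {0..<q})"
    proof (rule inj_onI, clarsimp)
      fix x y i j assume e: "x mod g + g * i = y mod g + g * j"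
      then have "(x mod g + g * i) mod g = (y mod g + g * j) mod g" by simp
      then have "x mod g = y mod g" by simp
      then show "x mod g = y mod g \<and> i = j" using e assms by simp
    qed
    show "?f ` ((\<lambda>x. x mod g) ` X \<times> {0..<q}) = (\<lambda>x. x mod m) ` (X + mults g)"
    proof (intro equalityI subsetI)
      fix y assume "y \<in> ?f ` ((\<lambda>x. x mod g) ` X \<times> {0..<q})"
      then obtain x i where x: "x \<in> X" "0 \<le> i" "i < q" "y = x mod g + g * i" by auto
      have "y = x + g * (i - x div g)" using x(4) by (simp add: algebra_simps minus_div_mult_eq_mod [symmetric])
      then have "y \<in> X + mults g" using x(1) by (auto simp: mults_def intro: set_plus_intro)
      moreover have "0 \<le> y" using x assms by simp
      moreover have "y < m"
      proof -
        have "g * i \<le> g * (q - 1)" using x assms by (intro mult_left_mono) auto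
        moreover have "x mod g < g" using assms by simp
        ultimately show ?thesis using x(4) m by (simp add: algebra_simps)
      qed
      ultimately show "y \<in> (\<lambda>x. x mod m) ` (X + mults g)" by (auto simp: image_iff intro!: bexI[of _ y])
    next
      fix y assume "y \<in> (\<lambda>x. x mod m) ` (X + mults g)"
      then obtain x c where x: "x \<in> X" "y = (x + g * c) mod m" 
        by (auto simp: set_plus_def mults_def dvd_def)
      have y: "0 \<le> y" "y < m" using x assms by auto
      have "y mod g = x mod g" using x(2) assms(3) by (simp add: mod_mod_cancel)
      moreover have "0 \<le> y div g" using y assms by (simp add: pos_imp_zdiv_nonneg_iff)
      moreover have "y div g < q"
      proof -
        have "g * (y div g) = y - y mod g" by (simp add: minus_mod_eq_mult_div)
        moreover have "0 \<le> y mod g" using assms by simp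
        ultimately have "g * (y div g) < g * q" using y m by linarith
        then show ?thesis using assms by simp
      qed
      moreover have "y = ?f (y mod g, y div g)" by simp
      ultimately show "y \<in> ?f ` ((\<lambda>x. x mod g) ` X \<times> {0..<q})"
        using x(1) by (intro image_eqI[of _ _ "(y mod g, y div g)"]) auto
    qed
  qed
  then have "nres m (X + mults g) = card ((\<lambda>x. x mod g) ` X \<times> {0..<q})"
    unfolding nres_def by (metis bij_betw_same_card)
  then show ?thesis by (simp add: card_cartesian_product nres_def q_def)
qed

lemma nres_plus_mults_self:
  assumes "0 < m" shows "nres m (X + mults m) = nres m X"
  using nres_plus_mults[OF assms assms] assms by simp

lemma int_subgroup_mults:
  fixes H :: "int set"
  assumes "0 < m" "m \<in> H" and diff: "\<And>x y. x \<in> H \<Longrightarrow> y \<in> H \<Longrightarrow> x - y \<in> H"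
  obtains g where "0 < g" "H = mults g"
proof -
  have z: "0 \<in> H" using diff[OF assms(2,2)] by simp
  have neg: "- x \<in> H" if "x \<in> H" for x using diff[OF z that] by simp
  have add: "x + y \<in> H" if "x \<in> H" "y \<in> H" for x y using diff[OF that(1) neg[OF that(2)]] by simp
  have muln: "int n * x \<in> H" if "x \<in> H" for n x
    by (induction n) (auto simp: z algebra_simps intro: add that)
  have mul: "c * x \<in> H" if "x \<in> H" for c x
  proof (cases "0 \<le> c")
    case True then show ?thesis using muln[OF that, of "nat c"] by simp
  next
    case False then show ?thesis using neg[OF muln[OF that, of "nat (-c)"]] by simp
  qed
  define n where "n = (LEAST n. 0 < n \<and> int n \<in> H)"
  have n: "0 < n \<and> int n \<in> H" unfolding n_def
    by (rule LeastI[of _ "nat m"]) (use assms in simp)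
  have least: "n \<le> k" if "0 < k" "int k \<in> H" for k
    unfolding n_def by (rule Least_le) (use that in simp)
  have dvd: "int n dvd x" if "x \<in> H" for x
  proof (rule ccontr)
    assume "\<not> int n dvd x"
    then have "x mod int n \<noteq> 0" by (simp add: mod_eq_0_iff_dvd)
    moreover have "0 \<le> x mod int n" using n by simp
    ultimately have pos: "0 < x mod int n" by linarith
    have "x mod int n = x - (x div int n) * int n" by (simp add: minus_div_mult_eq_mod)
    then have "x mod int n \<in> H" using diff[OF that mul[of "int n" "x div int n"]] n by simp
    then have "n \<le> nat (x mod int n)" using least pos by simp
    moreover have "x mod int n < int n" using n by simp
    ultimately show False using pos by linarith
  qed
  have "x \<in> H" if "int n dvd x" for x
    using that mul[of "int n"] n by (metis dvd_div_mult_self)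
  with dvd have "H = mults (int n)" 
    by (auto simp: mults_def)
  then show ?thesis using that[of "int n"] n by simp
qed

section \<open>Submodularity and sumsets of residues\<close>

text \<open>Hamidoune's argument: two intersecting minimisers of the submodular function
  \<open>|B + X| - K |X|\<close> on nonempty sets of residues intersect in a minimiser, so the translates of a
  smallest minimiser are pairwise disjoint, and the one containing 0 is a subgroup.\<close>

lemma exists_subgroup_minimiser:
  fixes B :: "int set" and K :: real
  assumes m: "0 < m"
  obtains g where "0 < g" "g dvd m"
    "\<And>X. X \<noteq> {} \<Longrightarrow> (real (nres g B) - K) * nat (m div g) \<le> real (nres m (B + X)) - K * nres m X"
proof -
  define c where "c X = real (nres m (B + X)) - K * nres m X" for X
  \<comment> \<open>Periodic sets are the full preimages of sets of residues: taking residues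
    commutes with their intersection, which fails for general sets of integers.\<close>
  define per where "per X \<longleftrightarrow> X \<noteq> {} \<and> X + mults m = X" for X
  have perD: "y \<in> X" if "per X" "x \<in> X" "m dvd y - x" for X x y
  proof -
    have "x + (y - x) \<in> X + mults m" using that by (intro set_plus_intro) (auto simp: mults_def)
    then show ?thesis using that by (simp add: per_def)
  qed
  have perI: "per X" if "X \<noteq> {}" "\<And>x y. x \<in> X \<Longrightarrow> m dvd y - x \<Longrightarrow> y \<in> X" for X
  proof -
    have "X + mults m \<subseteq> X" using that(2) by (fastforce simp: set_plus_def mults_def)
    moreover have "X \<subseteq> X + mults m" by (rule subset_plus_mults)
    ultimately show ?thesis using that(1) by (auto simp: per_def)
  qed
  have perInt: "per (X \<inter> Y)" if "per X" "per Y" "X \<inter> Y \<noteq> {}" for X Y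
    using that perD by (intro perI) blast+
  have perUn: "per (X \<union> Y)" if "per X" "per Y" for X Y
    using that perD by (intro perI) (auto simp: per_def)
  have submod: "c (X \<union> Y) + c (X \<inter> Y) \<le> c X + c Y" if "per X" "per Y" for X Y
  proof -
    let ?r = "\<lambda>X. (\<lambda>x. x mod m) ` X"
    have "?r (X \<inter> Y) = ?r X \<inter> ?r Y"
    proof
      show "?r X \<inter> ?r Y \<subseteq> ?r (X \<inter> Y)"
      proof
        fix z assume "z \<in> ?r X \<inter> ?r Y"
        then obtain x y where xy: "x \<in> X" "y \<in> Y" "z = x mod m" "z = y mod m" by auto
        then have "m dvd x - y" by (metis mod_eq_dvd_iff)
        then have "x \<in> Y" using perD that(2) xy by blast
        then show "z \<in> ?r (X \<inter> Y)" using xy by auto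
      qed
    qed auto
    then have 1: "nres m (X \<union> Y) + nres m (X \<inter> Y) = nres m X + nres m Y"
      using card_Un_Int[OF finite_residues[OF m] finite_residues[OF m], of X Y] unfolding nres_def by (simp add: image_Un)
    have "B + (X \<union> Y) = (B + X) \<union> (B + Y)" "B + (X \<inter> Y) \<subseteq> (B + X) \<inter> (B + Y)"
      by (auto simp: set_plus_def)
    then have "nres m (B + (X \<union> Y)) + nres m (B + (X \<inter> Y))
      \<le> card (?r (B + X) \<union> ?r (B + Y)) + card (?r (B + X) \<inter> ?r (B + Y))"
      unfolding nres_def by (intro add_mono card_mono finite_residues[OF m] finite_UnI finite_Int disjI1) auto
    also have "\<dots> = nres m (B + X) + nres m (B + Y)"
      using card_Un_Int[OF finite_residues[OF m] finite_residues[OF m], of "B + X" "B + Y"] unfolding nres_def by simp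
    finally have 2: "nres m (B + (X \<union> Y)) + nres m (B + (X \<inter> Y)) \<le> nres m (B + X) + nres m (B + Y)" .
    have "K * (real (nres m (X \<union> Y)) + nres m (X \<inter> Y)) = K * (real (nres m X) + nres m Y)"
      using 1 by (metis of_nat_add)
    moreover have "real (nres m (B + (X \<union> Y))) + nres m (B + (X \<inter> Y)) \<le> real (nres m (B + X)) + nres m (B + Y)"
      using 2 by linarith
    ultimately show ?thesis unfolding c_def by (simp add: algebra_simps)
  qed
  have transl: "per ((\<lambda>x. t + x) ` X)" "c ((\<lambda>x. t + x) ` X) = c X" if "per X" for t X
  proof -
    show "per ((\<lambda>x. t + x) ` X)"
    proof (rule perI)
      fix x y assume "x \<in> (\<lambda>x. t + x) ` X" "m dvd y - x"
      then obtain x' where "x' \<in> X" "x = t + x'" by auto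
      then have "y - t \<in> X" using perD[OF that, of x' "y - t"] \<open>m dvd y - x\<close> by (simp add: algebra_simps)
      then show "y \<in> (\<lambda>x. t + x) ` X" by (auto simp: image_iff intro!: bexI[of _ "y - t"])
    qed (use that in \<open>auto simp: per_def\<close>)
    have "B + (\<lambda>x. t + x) ` X = (\<lambda>x. t + x) ` (B + X)"
      by (auto simp: set_plus_def image_iff) (metis add.left_commute)+
    then show "c ((\<lambda>x. t + x) ` X) = c X" by (simp add: c_def nres_translate)
  qed
  have perU: "per UNIV" by (rule perI) auto
  have fin: "finite (c ` Collect per)"
  proof (rule finite_subset)
    show "c ` Collect per \<subseteq> (\<lambda>(i, j). real i - K * real j) ` ({..nat m} \<times> {..nat m})"
      using nres_le[OF m] by (auto simp: c_def image_iff intro!: bexI[of _ "(_, _)"])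
  qed auto
  define \<kappa> where "\<kappa> = Min (c ` Collect per)"
  have \<kappa>: "\<kappa> \<le> c X" if "per X" for X unfolding \<kappa>_def using fin that by (intro Min_le) auto
  have "\<kappa> \<in> c ` Collect per" unfolding \<kappa>_def using fin perU by (intro Min_in) auto
  then have ex: "\<exists>X. per X \<and> c X = \<kappa>" by auto
  define frag where "frag X \<longleftrightarrow> per X \<and> c X = \<kappa>" for X
  obtain X0 where X0: "frag X0" and minX0: "\<And>X. frag X \<Longrightarrow> nres m X0 \<le> nres m X"
    using ex exists_least_iff[of "\<lambda>n. \<exists>X. frag X \<and> nres m X = n"] unfolding frag_def by (metis not_le)
  have nres_eq: "X = Y" if "per X" "per Y" "X \<subseteq> Y" "nres m Y \<le> nres m X" for X Y
  proof -
    have "(\<lambda>x. x mod m) ` X = (\<lambda>x. x mod m) ` Y"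
      using that(3,4) unfolding nres_def by (intro card_seteq finite_residues m image_mono)
    then have "Y \<subseteq> X" using perD[OF that(1)] by (metis (no_types, lifting) image_iff mod_eq_dvd_iff subsetI)
    then show ?thesis using that by auto
  qed
  have atoms: "X = Y" if "frag X" "frag Y" "nres m X = nres m X0" "nres m Y = nres m X0" "X \<inter> Y \<noteq> {}" for X Y
  proof -
    have p: "per X" "per Y" "per (X \<inter> Y)" "per (X \<union> Y)" using that perInt perUn by (auto simp: frag_def)
    have "c (X \<inter> Y) = \<kappa>"
      using submod[OF p(1,2)] \<kappa>[OF p(3)] \<kappa>[OF p(4)] that by (simp add: frag_def)
    then have "frag (X \<inter> Y)" using p by (simp add: frag_def)
    then have "nres m X0 \<le> nres m (X \<inter> Y)" by (rule minX0)
    then have "X \<inter> Y = X" "X \<inter> Y = Y" using nres_eq p that by auto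
    then show ?thesis by simp
  qed
  obtain t where t: "t \<in> X0" using X0 by (auto simp: frag_def per_def)
  define H where "H = (\<lambda>x. - t + x) ` X0"
  have H: "frag H" "nres m H = nres m X0" "0 \<in> H"
    using X0 transl[of X0 "- t"] t
    by (simp_all only: frag_def H_def nres_translate) (auto simp: image_iff)
  \<comment> \<open>The translate of \<open>H\<close> by \<open>- y\<close> contains 0, hence meets
    \<open>H\<close> and equals it.\<close>
  have "x - y \<in> H" if "x \<in> H" "y \<in> H" for x y
  proof -
    have "(\<lambda>x. - y + x) ` H = H"
    proof (rule atoms)
      show "frag ((\<lambda>x. - y + x) ` H)" using H(1) transl[of H "- y"] by (simp only: frag_def)
      show "(\<lambda>x. - y + x) ` H \<inter> H \<noteq> {}" using H that by (auto simp: image_iff intro!: exI[of _ 0])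
      show "nres m ((\<lambda>x. - y + x) ` H) = nres m X0" by (simp only: nres_translate H)
    qed (use H in auto)
    then show ?thesis using that by (auto simp: image_iff)
  qed
  moreover have "m \<in> H" using perD[of H 0 m] H by (auto simp: frag_def)
  ultimately obtain g where g: "0 < g" "H = mults g" using int_subgroup_mults[OF m] by metis
  have gm: "g dvd m" using \<open>m \<in> H\<close> g by (simp add: mults_def)
  show ?thesis
  proof (rule that[OF g(1) gm])
    fix X :: "int set" assume "X \<noteq> {}"
    have "per (X + mults m)"
      using \<open>X \<noteq> {}\<close> subset_plus_mults[of X m]
      by (auto simp only: per_def add.assoc set_plus_mults_self[OF dvd_refl])
    then have "c H \<le> c (X + mults m)" using \<kappa> H by (simp add: frag_def)
    also have "\<dots> = c X" 
      using nres_plus_mults_self[OF m] by (simp add: c_def add.assoc[symmetric])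
    finally have "c H \<le> c X" .
    moreover have "nres m H = nat (m div g)"
    proof -
      have "{0} + mults g = H" using g by (simp add: set_plus_def)
      with nres_plus_mults[OF m g(1) gm, of "{0}"] show ?thesis by (simp add: nres_def[of g])
    qed
    moreover have "nres m (B + H) = nres g B * nat (m div g)" using nres_plus_mults[OF m g(1) gm] g by simp
    ultimately show "(real (nres g B) - K) * nat (m div g) \<le> real (nres m (B + X)) - K * nres m X"
      by (simp add: c_def algebra_simps)
  qed
qed

text \<open>A weak Cauchy-Davenport inequality with slope \<open>K\<close>. Modulo a prime the
  minimising subgroup is trivial or everything; the latter would force at least
  \<open>(1 - K) * p\<close> residues in the sumset, which \<open>small\<close> excludes.\<close>

lemma nres_add_lower_prime:
  fixes B X :: "int set" and K :: real
  assumes p: "prime p" and K: "0 \<le> K" and ne: "B \<noteq> {}" "X \<noteq> {}"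
    and small: "real (nres (int p) (B + X)) < (1 - K) * p"
  shows "real (nres (int p) B) + K * (real (nres (int p) X) - 1) \<le> real (nres (int p) (B + X))"
proof -
  have p0: "0 < int p" using p prime_gt_0_nat by simp
  obtain g where g: "0 < g" "g dvd int p" and le:
    "\<And>X. X \<noteq> {} \<Longrightarrow> (real (nres g B) - K) * nat (int p div g) \<le> real (nres (int p) (B + X)) - K * nres (int p) X"
    using exists_subgroup_minimiser[OF p0] by metis
  have "nat g dvd p" using g by (metis int_dvd_int_iff int_nat_eq less_imp_le)
  then consider "nat g = 1" | "nat g = p" using p by (auto simp: prime_nat_iff)
  then show ?thesis
  proof cases
    case 1
    then have g1: "g = 1" by simp
    have "(\<lambda>x. x mod g) ` B = {0}" using ne by (auto simp: g1)
    then have "nres g B = 1" by (simp add: nres_def)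
    with le[OF ne(2)] g1 have "(1 - K) * p \<le> real (nres (int p) (B + X)) - K * nres (int p) X" by simp
    then show ?thesis using small K mult_nonneg_nonneg[OF K, of "real (nres (int p) X)"] by linarith
  next
    case 2
    then have "g = int p" using g by linarith
    then show ?thesis using le[OF ne(2)] p0 by (simp add: algebra_simps)
  qed
qed

text \<open>The translates of \<open>X\<close> by \<open>Min Y\<close> and of \<open>Y\<close> by
  \<open>Max X\<close> share only \<open>Max X + Min Y\<close>.\<close>

lemma card_set_plus_int_ge:
  fixes X Y :: "int set"
  assumes "finite X" "finite Y" "X \<noteq> {}" "Y \<noteq> {}"
  shows "card X + card Y \<le> card (X + Y) + 1"
proof -
  let ?P = "(\<lambda>x. x + Min Y) ` X" and ?Q = "(\<lambda>y. Max X + y) ` Y"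
  have "?P \<inter> ?Q \<subseteq> {Max X + Min Y}"
  proof
    fix z assume "z \<in> ?P \<inter> ?Q"
    then obtain x y where "x \<in> X" "y \<in> Y" "z = x + Min Y" "z = Max X + y" by auto
    moreover have "x \<le> Max X" "Min Y \<le> y" using calculation assms by auto
    ultimately show "z \<in> {Max X + Min Y}" by simp
  qed
  then have "card (?P \<inter> ?Q) \<le> 1" using card_mono[of "{Max X + Min Y}"] by fastforce
  moreover have "card ?P = card X" "card ?Q = card Y" by (simp_all add: card_image inj_on_def)
  moreover have "card (?P \<union> ?Q) \<le> card (X + Y)"
    using assms by (intro card_mono finite_set_plus) (auto intro!: set_plus_intro Min_in Max_in)
  moreover have "card ?P + card ?Q = card (?P \<union> ?Q) + card (?P \<inter> ?Q)"
    using assms by (intro card_Un_Int) auto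
  ultimately show ?thesis by linarith
qed

text \<open>Every residue of \<open>A + A\<close> modulo the length of \<open>A\<close> survives the removal of \<open>l + A\<close>:
  \<open>l + a\<close> is represented by \<open>a = 0 + a\<close>.\<close>

lemma card_set_plus_ge_nres_add_card:
  fixes A :: "int set"
  assumes fin: "finite A" and A: "0 \<in> A" "l \<in> A" "A \<subseteq> {0..l}" "0 < l"
  shows "nres l (A + A) + card A \<le> card (A + A)"
proof -
  let ?L = "(\<lambda>a. l + a) ` A"
  have LA: "?L \<subseteq> A + A" using A by (auto intro: set_plus_intro)
  have "(\<lambda>x. x mod l) ` (A + A) \<subseteq> (\<lambda>x. x mod l) ` (A + A - ?L)"
  proof (rule image_subsetI)
    fix x assume x: "x \<in> A + A"
    show "x mod l \<in> (\<lambda>x. x mod l) ` (A + A - ?L)"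
    proof (cases "x \<in> ?L")
      case False then show ?thesis using x by blast
    next
      case True
      then obtain a where a: "a \<in> A" "x = l + a" by auto
      \<comment> \<open>For \<open>a = l\<close> the representative \<open>0 + l\<close> is itself
        removed, being \<open>l + 0\<close>; the residue 0 is then represented by
        \<open>0 + 0\<close>.\<close>
      define b where "b = (if a = l then 0 else a)"
      have "b \<in> A" using a A by (simp add: b_def)
      then have "0 + b \<in> A + A" using A by (intro set_plus_intro)
      moreover have "b < l" using a A by (auto simp: b_def)
      then have "b \<notin> ?L" using A by auto
      moreover have "x mod l = b mod l" using a by (simp add: b_def)
      ultimately show ?thesis by simp
    qed
  qed
  then have "nres l (A + A) \<le> nres l (A + A - ?L)"
    unfolding nres_def using A by (intro card_mono finite_residues)
  also have "\<dots> \<le> card (A + A - ?L)" using fin by (intro nres_le_card finite_Diff finite_set_plus)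
  also have "\<dots> = card (A + A) - card ?L" using LA fin by (intro card_Diff_subset) auto
  also have "card ?L = card A" by (simp add: card_image)
  finally show ?thesis
    using card_mono[OF finite_set_plus[OF fin fin] LA] nres_pos[of l "A + A"] \<open>card ?L = card A\<close> A by force
qed

text \<open>If \<open>|B + B| < 3/2 |B|\<close>, then a difference \<open>x\<close> of two elements of \<open>B\<close> has more than \<open>|B|/2\<close>
  representations, because the translates of \<open>B\<close> by these two elements meet in more than \<open>|B|/2\<close>
  points; hence differences of differences are differences.\<close>

lemma nres_set_plus_self_eq_modulus:
  fixes B :: "int set"
  assumes m: "0 < m" and B0: "0 \<in> B" and gen: "\<And>g. 0 < g \<Longrightarrow> g dvd m \<Longrightarrow> (\<forall>b\<in>B. g dvd b) \<Longrightarrow> g = 1"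
    and small: "2 * nres m (B + B) < 3 * nres m B"
  shows "nres m (B + B) = nat m"
proof -
  define R where "R = (\<lambda>x. x mod m) ` B"
  have finR: "finite R" and cR: "card R = nres m B" using finite_residues[OF m] by (auto simp: R_def nres_def)
  have Rm: "r mod m = r" if "r \<in> R" for r using that by (auto simp: R_def)
  define W where "W x = {(u, v) \<in> R \<times> R. (u - v) mod m = x mod m}" for x
  have finW: "finite (W x)" for x using finR by (intro finite_subset[of "W x" "R \<times> R"]) (auto simp: W_def)
  have many: "nres m B < 2 * card (W (a - b))" if "a \<in> B" "b \<in> B" for a b
  proof -
    define Ta Tb where "Ta = (\<lambda>u. (a + u) mod m) ` B" and "Tb = (\<lambda>u. (b + u) mod m) ` B"
    have c: "card Ta = nres m B" "card Tb = nres m B"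
      using nres_translate[of m a B] nres_translate[of m b B] by (simp_all add: Ta_def Tb_def nres_def image_image)
    have f: "finite Ta" "finite Tb" unfolding Ta_def Tb_def using finite_residues[OF m, of "(\<lambda>u. a + u) ` B"]
        finite_residues[OF m, of "(\<lambda>u. b + u) ` B"] by (simp_all add: image_image)
    have "card (Ta \<union> Tb) \<le> nres m (B + B)" unfolding nres_def Ta_def Tb_def using that
      by (intro card_mono finite_residues m) (auto intro!: imageI set_plus_intro)
    with card_Un_Int[OF f] c have 1: "2 * nres m B \<le> nres m (B + B) + card (Ta \<inter> Tb)" by linarith
    \<comment> \<open>A common point \<open>t = a + u = b + v\<close> of the two translates gives
      the representation \<open>v - u = a - b\<close> modulo \<open>m\<close>.\<close>
    define F where "F t = ((t - b) mod m, (t - a) mod m)" for t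
    have "inj_on F (Ta \<inter> Tb)"
    proof (rule inj_onI)
      fix s t assume st: "s \<in> Ta \<inter> Tb" "t \<in> Ta \<inter> Tb" "F s = F t"
      then have "s mod m = t mod m" by (simp add: F_def mod_eq_dvd_iff)
      moreover have "s mod m = s" "t mod m = t" using st by (auto simp: Ta_def)
      ultimately show "s = t" by simp
    qed
    moreover have "F ` (Ta \<inter> Tb) \<subseteq> W (a - b)"
    proof (rule image_subsetI)
      fix t assume "t \<in> Ta \<inter> Tb"
      then obtain u v where uv: "u \<in> B" "v \<in> B" "t = (a + u) mod m" "t = (b + v) mod m" by (auto simp: Ta_def Tb_def)
      have "(t - b) mod m = v mod m" using uv(4) by (simp add: mod_diff_left_eq)
      moreover have "(t - a) mod m = u mod m" using uv(3) by (simp add: mod_diff_left_eq)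
      moreover have "(v mod m - u mod m) mod m = (a - b) mod m"
      proof -
        have "m dvd (a + u) - (b + v)" using uv by (metis mod_eq_dvd_iff)
        then have "m dvd (b + v) - (a + u)" by (metis dvd_minus_iff minus_diff_eq)
        moreover have "(v - u) - (a - b) = (b + v) - (a + u)" by simp
        ultimately have "m dvd (v - u) - (a - b)" by (simp only:)
        then show ?thesis by (simp add: mod_diff_eq mod_eq_dvd_iff)
      qed
      ultimately show "F t \<in> W (a - b)" using uv by (auto simp: F_def W_def R_def)
    qed
    ultimately have "card (Ta \<inter> Tb) \<le> card (W (a - b))" using finW card_inj_on_le by blast
    then show ?thesis using 1 small by linarith
  qed
  define D where "D = {x. \<exists>a\<in>B. \<exists>b\<in>B. m dvd x - (a - b)}"
  have Wcong: "W x = W y" if "m dvd x - y" for x y using that by (auto simp: W_def mod_eq_dvd_iff[symmetric])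
  have Dmany: "nres m B < 2 * card (W x)" if "x \<in> D" for x
    using that many Wcong by (fastforce simp: D_def)
  have "x - y \<in> D" if "x \<in> D" "y \<in> D" for x y
  proof -
    \<comment> \<open>A pair in \<open>W z\<close> is determined by its first component. So the
      first components for \<open>x\<close> and for \<open>y\<close> each fill more than half of
      \<open>R\<close> and share some \<open>u\<close>; modulo \<open>m\<close>,
      \<open>x = u - v\<close> and \<open>y = u - v'\<close> yield
      \<open>x - y = v' - v\<close>.\<close>
    have cfst: "card (fst ` W z) = card (W z)" for z
    proof (rule card_image, rule inj_onI, clarsimp simp: W_def)
      fix u v v' assume "u \<in> R" "v \<in> R" "v' \<in> R" "(u - v) mod m = z mod m" "(u - v') mod m = z mod m"
      then have "m dvd (u - v) - (u - v')" by (metis mod_eq_dvd_iff)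
      then have "m dvd v' - v" by simp
      then have "v' mod m = v mod m" by (simp add: mod_eq_dvd_iff)
      then show "v = v'" using Rm \<open>v \<in> R\<close> \<open>v' \<in> R\<close> by simp
    qed
    have "card (fst ` W x \<union> fst ` W y) \<le> card R" using finR by (intro card_mono) (auto simp: W_def)
    moreover have "card (fst ` W x) + card (fst ` W y) = card (fst ` W x \<union> fst ` W y) + card (fst ` W x \<inter> fst ` W y)"
      using finW by (intro card_Un_Int) auto
    ultimately have "card (fst ` W x \<inter> fst ` W y) \<noteq> 0"
      using Dmany[OF that(1)] Dmany[OF that(2)] unfolding cfst cR by linarith
    then obtain u where "u \<in> fst ` W x \<inter> fst ` W y" by (metis card.empty ex_in_conv)
    then obtain v v' where v: "v \<in> R" "v' \<in> R" "(u - v) mod m = x mod m" "(u - v') mod m = y mod m"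
      by (auto simp: W_def)
    obtain c c' where c: "c \<in> B" "c' \<in> B" "v = c mod m" "v' = c' mod m" using v by (auto simp: R_def)
    have d: "m dvd x - (u - v)" "m dvd (u - v') - y" "m dvd v - c" "m dvd c' - v'"
      using v c by (metis mod_eq_dvd_iff mod_mod_trivial)+
    have "m dvd (x - (u - v)) + ((u - v') - y) - (v - c) - (c' - v')"
      by (rule dvd_diff[OF dvd_diff[OF dvd_add[OF d(1,2)] d(3)] d(4)])
    also have "\<dots> = (x - y) - (c' - c)" by simp
    finally show ?thesis using c by (auto simp: D_def)
  qed
  moreover have mD: "m \<in> D" using B0 by (auto simp: D_def intro!: bexI[of _ 0])
  ultimately obtain g where g: "0 < g" "D = mults g" using int_subgroup_mults[OF m] by metis
  have "b \<in> D" if "b \<in> B" for b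
  proof -
    have "m dvd b - (b - 0)" by simp
    then show ?thesis using that B0 unfolding D_def by blast
  qed
  then have "g = 1" using gen[OF g(1)] mD g(2) by (auto simp: mults_def)
  then have all: "x \<in> D" for x using g by (simp add: mults_def)
  \<comment> \<open>Write n for \<open>nres m B\<close>. Every residue is now a difference with more
    than n/2 representations, so \<open>m (n + 1) <= 2 n^2\<close> and \<open>m < 2 n\<close>; by
    pigeonhole \<open>R\<close> then meets \<open>z - R\<close> for every \<open>z\<close>.\<close>
  have b0: "0 < nres m B" using nres_pos[OF m] B0 by auto
  have "W y \<inter> W z = {}" if "y \<in> {0..<m}" "z \<in> {0..<m}" "y \<noteq> z" for y z
  proof -
    have "y mod m \<noteq> z mod m" using that by simp
    then show ?thesis by (auto simp: W_def)
  qed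
  then have "card (\<Union>z\<in>{0..<m}. W z) = (\<Sum>z\<in>{0..<m}. card (W z))"
    using finW by (intro card_UN_disjoint) blast+
  moreover have "(\<Union>z\<in>{0..<m}. W z) = R \<times> R" using m by (force simp: W_def)
  ultimately have "card (R \<times> R) = (\<Sum>z\<in>{0..<m}. card (W z))" by simp
  then have "2 * (nres m B * nres m B) = (\<Sum>z\<in>{0..<m}. 2 * card (W z))"
    by (simp add: card_cartesian_product cR sum_distrib_left)
  also have "\<dots> \<ge> (\<Sum>z\<in>{0..<m}. nres m B + 1)" using Dmany[OF all] by (intro sum_mono) (simp add: Suc_le_eq)
  finally have "nat m * (nres m B + 1) \<le> 2 * (nres m B * nres m B)" by simp
  moreover have "0 < nat m" using m by simp
  ultimately have "nat m * nres m B < (2 * nres m B) * nres m B" unfolding distrib_left mult.assoc by linarith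
  then have big: "nat m < 2 * nres m B" by simp
  have "(\<lambda>x. x mod m) ` (B + B) = {0..<m}"
  proof (intro equalityI subsetI)
    fix z assume z: "z \<in> {0..<m}"
    define S where "S = (\<lambda>v. (z - v) mod m) ` R"
    have "inj_on (\<lambda>v. (z - v) mod m) R"
    proof (rule inj_onI)
      fix u v assume uv: "u \<in> R" "v \<in> R" "(z - u) mod m = (z - v) mod m"
      then have "m dvd v - u" by (simp add: mod_eq_dvd_iff)
      then show "u = v" using Rm uv by (metis mod_eq_dvd_iff)
    qed
    then have "card S = nres m B" by (simp add: S_def card_image cR)
    moreover have "card (R \<union> S) \<le> card {0..<m}" using m by (intro card_mono) (auto simp: R_def S_def)
    moreover have "card R + card S = card (R \<union> S) + card (R \<inter> S)" using finR by (intro card_Un_Int) (auto simp: S_def)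
    ultimately have "card (R \<inter> S) \<noteq> 0" using big unfolding cR by (simp only: card_atLeastLessThan_int)
    then obtain u where "u \<in> R \<inter> S" by (metis card.empty ex_in_conv)
    then obtain a b where ab: "a \<in> B" "b \<in> B" "a mod m = (z - b mod m) mod m" by (auto simp: R_def S_def)
    then have "m dvd z - (a + b)"
      by (metis (no_types, opaque_lifting) diff_add_eq_diff_diff_swap diff_diff_eq mod_diff_right_eq mod_eq_dvd_iff)
    then have "z mod m = (a + b) mod m" by (simp add: mod_eq_dvd_iff)
    then have "z = (a + b) mod m" using z by simp
    then show "z \<in> (\<lambda>x. x mod m) ` (B + B)" using ab by (auto intro: set_plus_intro)
  qed (use m in auto)
  then show ?thesis by (simp add: nres_def)
qed

section \<open>Sets of integers with small doubling\<close>

lemma card_eq_sum_fibres: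
  assumes "finite A" shows "card A = (\<Sum>r\<in>f ` A. card {a \<in> A. f a = r})"
proof -
  have "card (\<Union>r\<in>f ` A. {a \<in> A. f a = r}) = (\<Sum>r\<in>f ` A. card {a \<in> A. f a = r})"
    using assms by (intro card_UN_disjoint) auto
  moreover have "(\<Union>r\<in>f ` A. {a \<in> A. f a = r}) = A" by auto
  ultimately show ?thesis by simp
qed

text \<open>Order the fibres of \<open>A\<close> modulo \<open>g\<close> by decreasing size. Besides the sums with the largest
  fibre, the hypothesis provides for each further fibre a new residue of \<open>A + A\<close> over which lies
  the sum of a fibre at least as large with some other fibre.\<close>

lemma card_set_plus_self_ge_of_residues:
  fixes A :: "int set"
  assumes g: "0 < g" and fin: "finite A" and two: "2 \<le> nres g A"
    and expand: "\<And>T. T \<subseteq> A \<Longrightarrow> T \<noteq> {} \<Longrightarrow> nres g A + nres g T \<le> nres g (A + T) + 1"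
  shows "3 * card A \<le> card (A + A) + nres g A + 1"
proof -
  define R where "R = (\<lambda>x. x mod g) ` A"
  define n where "n r = int (card {a \<in> A. a mod g = r})" for r
  define c where "c t = int (card {x \<in> A + A. x mod g = t})" for t
  define j where "j = card R"
  define up where "up S = {a \<in> A. a mod g \<in> S}" for S
  have finR: "finite R" using fin by (simp add: R_def)
  have finAA: "finite (A + A)" using fin by (intro finite_set_plus)
  have jA: "nres g A = j" by (simp add: nres_def R_def j_def)
  have k: "int (card A) = (\<Sum>r\<in>R. n r)"
    using card_eq_sum_fibres[OF fin, of "\<lambda>x. x mod g"] by (simp add: R_def n_def)
  have n1: "1 \<le> n r" if "r \<in> R" for r
  proof -
    have "{a \<in> A. a mod g = r} \<noteq> {}" using that by (auto simp: R_def)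
    then show ?thesis using fin by (simp add: n_def Suc_le_eq card_gt_0_iff)
  qed
  have fib: "n r + n s \<le> c ((r + s) mod g) + 1" if "r \<in> R" "s \<in> R" for r s
  proof -
    let ?X = "{a \<in> A. a mod g = r}" and ?Y = "{a \<in> A. a mod g = s}"
    have "card ?X + card ?Y \<le> card (?X + ?Y) + 1"
      using that fin by (intro card_set_plus_int_ge) (auto simp: R_def)
    moreover have "card (?X + ?Y) \<le> card {x \<in> A + A. x mod g = (r + s) mod g}"
    proof (rule card_mono)
      show "?X + ?Y \<subseteq> {x \<in> A + A. x mod g = (r + s) mod g}"
        by (auto simp: set_plus_def mod_simps)
    qed (use finAA in auto)
    ultimately show ?thesis by (simp add: n_def c_def)
  qed
  have R0: "R \<noteq> {}" using two jA by (auto simp: j_def)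
  obtain rx where rx: "rx \<in> R" "\<And>r. r \<in> R \<Longrightarrow> n r \<le> n rx"
    using finR R0 obtains_MAX[of R n] by (metis Max_ge finite_imageI imageI)
  obtain rn where rn: "rn \<in> R" "\<And>r. r \<in> R \<Longrightarrow> n rn \<le> n r"
    using finR R0 by (metis arg_min_if_finite(1) arg_min_least)
  \<comment> \<open>\<open>S\<close> holds the \<open>i + 1\<close> largest classes.
    \<open>W\<close> consists of the \<open>j\<close> residues of \<open>R + rx\<close>,
    contributing \<open>n r + n rx - 1\<close> each, and of one new residue per class added later,
    contributing \<open>n s + n rn - 1\<close>.\<close>
  have main: "\<exists>S W. S \<subseteq> R \<and> rx \<in> S \<and> card S = i + 1 \<and> (\<forall>s\<in>S. \<forall>r\<in>R - S. n r \<le> n s) \<and>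
     W \<subseteq> (\<lambda>x. x mod g) ` (A + up S) \<and> card W = j + i \<and>
     int j * n rx + int (card A) - int j + (\<Sum>s\<in>S - {rx}. n s + n rn - 1) \<le> (\<Sum>t\<in>W. c t)"
    if "i + 1 \<le> j" for i
    using that
  proof (induction i)
    case 0
    define W where "W = (\<lambda>r. (r + rx) mod g) ` R"
    have inj: "inj_on (\<lambda>r. (r + rx) mod g) R"
    proof (rule inj_onI)
      fix r s assume rs: "r \<in> R" "s \<in> R" "(r + rx) mod g = (s + rx) mod g"
      then have "g dvd r - s" by (simp add: mod_eq_dvd_iff)
      moreover have "r mod g = r" "s mod g = s" using rs by (auto simp: R_def)
      ultimately show "r = s" by (metis mod_eq_dvd_iff)
    qed
    have "W \<subseteq> (\<lambda>x. x mod g) ` (A + up {rx})"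
    proof
      fix t assume "t \<in> W"
      then obtain a where a: "a \<in> A" "t = (a mod g + rx) mod g" by (auto simp: W_def R_def)
      obtain b where b: "b \<in> A" "rx = b mod g" using rx by (auto simp: R_def)
      have "t = (a + b) mod g" using a b by (simp add: mod_simps)
      moreover have "a + b \<in> A + up {rx}" using a b by (intro set_plus_intro) (auto simp: up_def)
      ultimately show "t \<in> (\<lambda>x. x mod g) ` (A + up {rx})" by auto
    qed
    moreover have "card W = j" using inj by (simp add: W_def card_image j_def)
    moreover have "int j * n rx + int (card A) - int j \<le> (\<Sum>t\<in>W. c t)"
    proof -
      have "int j * n rx + int (card A) - int j = (\<Sum>r\<in>R. n r + n rx - 1)"
        by (simp add: k sum.distrib sum_subtractf j_def)
      also have "\<dots> \<le> (\<Sum>r\<in>R. c ((r + rx) mod g))" using fib rx(1) by (intro sum_mono) (smt (verit))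
      also have "\<dots> = (\<Sum>t\<in>W. c t)" using inj by (simp add: W_def sum.reindex)
      finally show ?thesis .
    qed
    ultimately show ?case using rx by (intro exI[of _ "{rx}"] exI[of _ W]) auto
  next
    case (Suc i)
    then obtain S W where S: "S \<subseteq> R" "rx \<in> S" "card S = i + 1" "\<And>s r. s \<in> S \<Longrightarrow> r \<in> R - S \<Longrightarrow> n r \<le> n s"
      and W: "W \<subseteq> (\<lambda>x. x mod g) ` (A + up S)" "card W = j + i"
      and le: "int j * n rx + int (card A) - int j + (\<Sum>s\<in>S - {rx}. n s + n rn - 1) \<le> (\<Sum>t\<in>W. c t)"
      by auto
    have finS: "finite S" using S finR finite_subset by blast
    have "R - S \<noteq> {}" using S Suc.prems card_mono[OF finS, of R] by (force simp: j_def)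
    then obtain r' where r': "r' \<in> R - S" "\<And>r. r \<in> R - S \<Longrightarrow> n r \<le> n r'"
      using finR obtains_MAX[of "R - S" n] by (metis finite_Diff Max_ge finite_imageI imageI)
    define S' where "S' = insert r' S"
    have S'R: "S' \<subseteq> R" using S r' by (auto simp: S'_def)
    have "(\<lambda>x. x mod g) ` up S' = S'" using S'R by (auto simp: up_def R_def)
    then have "nres g (up S') = i + 2" using S r' finS by (simp add: nres_def S'_def)
    moreover have "up S' \<noteq> {}" using calculation by (auto simp: nres_def)
    moreover have "up S' \<subseteq> A" by (auto simp: up_def)
    ultimately have "j + i + 1 \<le> nres g (A + up S')" using expand[of "up S'"] jA by simp
    then have "\<not> (\<lambda>x. x mod g) ` (A + up S') \<subseteq> W"
      using card_mono[of W "(\<lambda>x. x mod g) ` (A + up S')"] W finite_subset[OF W(1) finite_residues[OF g]]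
      by (auto simp: nres_def)
    then obtain t where t: "t \<in> (\<lambda>x. x mod g) ` (A + up S')" "t \<notin> W" by blast
    then obtain a b where ab: "a \<in> A" "b \<in> A" "b mod g \<in> S'" "t = (a + b) mod g"
      by (auto simp: set_plus_def up_def)
    \<comment> \<open>The class of \<open>b\<close> is in \<open>S'\<close>, where none is smaller
      than \<open>r'\<close>; nothing is known about the class of \<open>a\<close>, hence the
      minimum \<open>n rn\<close>.\<close>
    have "n rn + n r' \<le> n (a mod g) + n (b mod g)"
      using rn(2)[of "a mod g"] ab S(4)[of "b mod g" r'] r' by (auto simp: R_def S'_def)
    also have "\<dots> \<le> c t + 1" using fib[of "a mod g" "b mod g"] ab by (simp add: R_def mod_simps)
    finally have ct: "n rn + n r' \<le> c t + 1" .
    have finW: "finite W" using W finite_residues[OF g] finite_subset by blast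
    have "A + up S \<subseteq> A + up S'" by (rule set_plus_mono2) (auto simp: up_def S'_def)
    then have "insert t W \<subseteq> (\<lambda>x. x mod g) ` (A + up S')" using W t by blast
    moreover have "card (insert t W) = j + Suc i" using W t finW by simp
    moreover have "(\<Sum>s\<in>S' - {rx}. n s + n rn - 1) = n r' + n rn - 1 + (\<Sum>s\<in>S - {rx}. n s + n rn - 1)"
    proof -
      have "S' - {rx} = insert r' (S - {rx})" using S r' by (auto simp: S'_def)
      then show ?thesis using r' finS by simp
    qed
    moreover have "\<forall>s\<in>S'. \<forall>r\<in>R - S'. n r \<le> n s" using S(4) r' by (auto simp: S'_def)
    moreover have "(\<Sum>t\<in>insert t W. c t) = c t + (\<Sum>t\<in>W. c t)" using t finW by simp
    moreover have "card S' = Suc i + 1" using S r' finS by (simp add: S'_def)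
    ultimately show ?case using S'R S le ct
      by (intro exI[of _ S'] exI[of _ "insert t W"]) (auto simp: S'_def)
  qed
  have j2: "2 \<le> j" using two jA by simp
  then obtain S W where S: "S \<subseteq> R" "card S = j" and W: "W \<subseteq> (\<lambda>x. x mod g) ` (A + up S)"
    and le: "int j * n rx + int (card A) - int j + (\<Sum>s\<in>S - {rx}. n s + n rn - 1) \<le> (\<Sum>t\<in>W. c t)"
    using main[of "j - 1"] by auto
  have "S = R" using S finR by (simp add: j_def card_subset_eq)
  have "(\<Sum>t\<in>W. c t) \<le> (\<Sum>t\<in>(\<lambda>x. x mod g) ` (A + A). c t)"
  proof (rule sum_mono2)
    have "A + up S \<subseteq> A + A" by (rule set_plus_mono2) (auto simp: up_def)
    then show "W \<subseteq> (\<lambda>x. x mod g) ` (A + A)" using W by blast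
  qed (use finAA in \<open>auto simp: c_def\<close>)
  also have "\<dots> = int (card (A + A))"
    using card_eq_sum_fibres[OF finAA, of "\<lambda>x. x mod g"] by (simp add: c_def)
  finally have up: "(\<Sum>t\<in>W. c t) \<le> int (card (A + A))" .
  have "(\<Sum>s\<in>R - {rx}. n s + n rn - 1) = (\<Sum>s\<in>R - {rx}. n s) + int (card (R - {rx})) * (n rn - 1)"
    by (simp add: sum.distrib sum_subtractf algebra_simps)
  also have "(\<Sum>s\<in>R - {rx}. n s) = int (card A) - n rx" using finR rx by (simp add: k sum_diff1)
  also have "int (card (R - {rx})) = int j - 1" using finR rx j2 by (simp add: j_def)
  finally have s1: "(\<Sum>s\<in>R - {rx}. n s + n rn - 1) = int (card A) - n rx + (int j - 1) * (n rn - 1)" .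
  have "int (card A) = n rn + (\<Sum>r\<in>R - {rn}. n r)" using finR rn by (simp add: k sum.remove)
  also have "(\<Sum>r\<in>R - {rn}. n r) \<le> (\<Sum>r\<in>R - {rn}. n rx)" using rx by (intro sum_mono) auto
  also have "\<dots> = (int j - 1) * n rx" using finR rn j2 by (simp add: j_def)
  finally have s2: "int (card A) \<le> n rn + (int j - 1) * n rx" by simp
  \<comment> \<open>The bounds add up to \<open>3 |A| - j - 1 + (j - 2) (n rn - 1)\<close>, and the
    product is non-negative as soon as there are two classes.\<close>
  have s3: "0 \<le> (int j - 2) * (n rn - 1)" using j2 n1[OF rn(1)] by (intro mult_nonneg_nonneg) auto
  have "3 * int (card A) \<le> int (card (A + A)) + int j + 1"
    using le up s1 s2 s3 \<open>S = R\<close> by (simp add: algebra_simps)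
  then show ?thesis using jA by linarith
qed

text \<open>Only 0 and \<open>l\<close> can share a residue.\<close>

lemma card_le_nres_modulus_length:
  fixes A :: "int set"
  assumes "finite A" "A \<subseteq> {0..l}" "0 < l"
  shows "card A \<le> nres l A + 1"
proof -
  have "card (A - {l}) = nres l (A - {l})"
    using assms by (intro nres_eq_card[symmetric]) force
  also have "\<dots> \<le> nres l A" using assms by (intro nres_mono) auto
  finally show ?thesis using card_Diff1_le[of A l] assms by (cases "l \<in> A") (simp_all add: card_Diff_singleton)
qed

text \<open>Let \<open>H\<close> be the subgroup of the residues modulo \<open>l\<close> minimising \<open>|A + X| - 0.99 |X|\<close>. The doubling
  bound forces \<open>A\<close> to meet at most six cosets of \<open>H\<close>. If it meets one, then \<open>H\<close> is everything, and
  minimality bounds \<open>l\<close>. Otherwise minimality makes the cosets grow as in the Cauchy-Davenport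
  theorem, since \<open>0.99\<close> is close enough to 1 for sets of at most six elements, so
  \<open>|A + A| \<ge> 3 |A| - 7\<close>. The constant \<open>2.835\<close> exceeds \<open>2.48 \<cdot> 8/7\<close>, the doubling of a subset
  containing 7/8 of the set in the theorem.\<close>

lemma length_le_of_small_doubling:
  fixes A :: "int set"
  assumes fin: "finite A" and A: "0 \<in> A" "l \<in> A" "A \<subseteq> {0..l}" "0 < l"
    and gcd1: "\<And>g. 0 < g \<Longrightarrow> (\<forall>a\<in>A. g dvd a) \<Longrightarrow> g = 1"
    and small: "real (card (A + A)) \<le> 2.835 * real (card A) - 7"
  shows "l \<le> 85 * int (card A)"
proof -
  define k where "k = real (card A)"
  obtain g where g: "0 < g" "g dvd l" and le:
    "\<And>X. X \<noteq> {} \<Longrightarrow> (real (nres g A) - 0.99) * nat (l div g) \<le> real (nres l (A + X)) - 0.99 * nres l X"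
    using exists_subgroup_minimiser[OF A(4)] by metis
  define j h where "j = nres g A" and "h = real (nat (l div g))"
  have hpos: "1 \<le> h"
  proof -
    have "1 \<le> l div g" using g A by (simp add: pos_imp_zdiv_pos_iff zdvd_imp_le int_one_le_iff_zero_less)
    then show ?thesis by (simp add: h_def)
  qed
  have nA: "k \<le> real (nres l A) + 1" 
    using card_le_nres_modulus_length[OF fin A(3,4)] by (simp add: k_def)
  have nAA: "real (nres l (A + A)) \<le> 2.835 * k - 7 - k" 
    using card_set_plus_ge_nres_add_card[OF fin A] small by (simp add: k_def)
  have "A \<noteq> {}" using A by auto
  have "(real j - 0.99) * h \<le> real (nres l (A + A)) - 0.99 * nres l A"
    using le[OF \<open>A \<noteq> {}\<close>] by (simp add: j_def h_def)
  \<comment> \<open>\<open>0.845 = 2.835 - 1 - 0.99\<close>: the 1 is the removed copy of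
    \<open>A\<close>, the 0.99 the coefficient of the submodular function.\<close>
  with nA nAA have 1: "(real j - 0.99) * h \<le> 0.845 * k - 6.01" by simp
  have jpos: "1 \<le> j" using nres_pos[OF g(1) \<open>A \<noteq> {}\<close>] by (simp add: j_def)
  show ?thesis
  proof (cases "j = 1")
    case True
    then obtain r where r: "(\<lambda>x. x mod g) ` A = {r}" unfolding j_def nres_def by (auto simp: card_1_singleton_iff)
    then have "r = 0" using A(1) by force
    then have "\<forall>a\<in>A. g dvd a" using r by auto
    then have "g = 1" using gcd1 g by blast
    then have "h = real_of_int l" using A by (simp add: h_def)
    then have "real_of_int l \<le> 85 * k" using 1 True by (simp add: k_def)
    then show ?thesis unfolding k_def by linarith
  next
    case False
    have "nres l A \<le> nres l (A + mults g)" using A subset_plus_mults by (intro nres_mono)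
    also have "\<dots> = j * nat (l div g)" using nres_plus_mults[OF A(4) g] by (simp add: j_def)
    finally have "real (nres l A) \<le> real j * h" unfolding h_def of_nat_mult[symmetric] of_nat_le_iff .
    with nA have "k \<le> real j * h + 1" by simp
    \<comment> \<open>\<open>A\<close> lies in \<open>j\<close> cosets of order \<open>h\<close>, so
      \<open>k\<close> is at most \<open>j * h + 1\<close>, and \<open>0.155 = 1 - 0.845\<close>. As
      \<open>0.99 / 0.155 < 7\<close>, at most six cosets occur.\<close>
    with 1 have "(0.155 * real j - 0.99) * h < 0" by (simp add: algebra_simps)
    then have "0.155 * real j < 0.99" using hpos by (simp add: mult_less_0_iff)
    then have j6: "j \<le> 6" by simp
    have "3 * card A \<le> card (A + A) + nres g A + 1"
    proof (rule card_set_plus_self_ge_of_residues[OF g(1) fin])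
      show "2 \<le> nres g A" using False jpos by (simp add: j_def)
      fix T assume T: "T \<subseteq> A" "T \<noteq> {}"
      have "T + mults g \<noteq> {}" using T subset_plus_mults[of T g] by auto
      from le[OF this] have "(real j - 0.99) * h \<le> real (nres g (A + T)) * h - 0.99 * (real (nres g T) * h)"
        unfolding add.assoc[symmetric] nres_plus_mults[OF A(4) g] of_nat_mult j_def h_def .
      then have "(real j - 0.99) * h \<le> (real (nres g (A + T)) - 0.99 * real (nres g T)) * h"
        by (simp only: left_diff_distrib mult.assoc)
      then have "real j - 0.99 \<le> real (nres g (A + T)) - 0.99 * real (nres g T)"
        using hpos by (simp add: mult_le_cancel_right)
      moreover have "nres g T \<le> 6" using nres_mono[OF g(1) T(1)] j6 by (simp add: j_def)
      \<comment> \<open>The loss is at most \<open>0.99 + 0.01 * 6 = 1.05 < 2\<close>, hence at most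
        1 by integrality.\<close>
      ultimately have "real (nres g A) + real (nres g T) < real (nres g (A + T)) + 2" by (simp add: j_def)
      then show "nres g A + nres g T \<le> nres g (A + T) + 1" by linarith
    qed
    \<comment> \<open>The 7 is \<open>j + 1\<close> for six cosets; the 7 in \<open>small\<close>
      cancels it.\<close>
    then have "3 * k \<le> real (card (A + A)) + 7" using j6 unfolding k_def j_def by linarith
    moreover have "0 < k" using fin \<open>A \<noteq> {}\<close> by (simp add: k_def card_gt_0_iff)
    ultimately show ?thesis using small by (simp add: k_def)
  qed
qed

text \<open>Removing a copy of \<open>A\<close> leaves fewer than \<open>3/2 (|A| - 1)\<close>
  residues for \<open>A + A\<close>, while \<open>A\<close> has at least \<open>|A| - 1\<close>; the
  3 in \<open>small\<close> pays for 0 and \<open>l\<close> coinciding. So \<open>A + A\<close>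
  covers all residues modulo \<open>l\<close>.\<close>

lemma length_le_of_very_small_doubling:
  fixes A :: "int set"
  assumes fin: "finite A" and A: "0 \<in> A" "l \<in> A" "A \<subseteq> {0..l}" "0 < l"
    and gcd1: "\<And>g. 0 < g \<Longrightarrow> (\<forall>a\<in>A. g dvd a) \<Longrightarrow> g = 1"
    and small: "2 * card (A + A) + 3 < 5 * card A"
  shows "l + int (card A) \<le> int (card (A + A))"
proof -
  have "nres l (A + A) = nat l"
    using card_set_plus_ge_nres_add_card[OF fin A] card_le_nres_modulus_length[OF fin A(3,4)] small gcd1
    by (intro nres_set_plus_self_eq_modulus A) auto
  then show ?thesis using card_set_plus_ge_nres_add_card[OF fin A] A by linarith
qed

text \<open>Subtract the minimum and divide by the gcd of the differences. The affine map keeps the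
  size of the sumset, and gcd 1 keeps the copy out of proper subgroups modulo its length.\<close>

lemma int_set_normal_form:
  fixes A :: "int set"
  assumes fin: "finite A" and two: "2 \<le> card A"
  obtains c d B l where "0 < d" "A = (\<lambda>b. c + d * b) ` B" "finite B" "0 \<in> B" "l \<in> B" "B \<subseteq> {0..l}" "0 < l"
    "\<forall>g>0. (\<forall>b\<in>B. g dvd b) \<longrightarrow> g = 1" "card B = card A" "card (B + B) = card (A + A)"
proof -
  have ne: "A \<noteq> {}" using two by auto
  define c where "c = Min A"
  have c: "c \<in> A" "\<And>a. a \<in> A \<Longrightarrow> c \<le> a" using fin ne by (auto simp: c_def)
  define d where "d = Gcd ((\<lambda>a. a - c) ` A)"
  define B where "B = (\<lambda>a. (a - c) div d) ` A"
  have dd: "d dvd a - c" if "a \<in> A" for a using that by (auto simp: d_def)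
  have "\<exists>a\<in>A. a \<noteq> c"
  proof (rule ccontr)
    assume "\<not> ?thesis"
    then have "A \<subseteq> {c}" by auto
    then have "card A \<le> card {c}" by (intro card_mono) auto
    then show False using two by simp
  qed
  then obtain a1 where a1: "a1 \<in> A" "a1 \<noteq> c" by blast
  have "d \<noteq> 0" using dd[OF a1(1)] a1 by auto
  moreover have "0 \<le> d" by (simp add: d_def)
  ultimately have d: "0 < d" by simp
  have "(\<lambda>b. c + d * b) ` B = (\<lambda>a. a) ` A"
    unfolding B_def image_image by (rule image_cong) (use dd in auto)
  then have AB: "A = (\<lambda>b. c + d * b) ` B" by simp
  have inj: "inj_on (\<lambda>b. c + d * b) X" for c X using d by (auto intro!: inj_onI)
  have finB: "finite B" using fin by (simp add: B_def)
  have B0: "0 \<in> B" using c by (force simp: B_def)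
  have Bnn: "0 \<le> b" if "b \<in> B" for b using that c d by (auto simp: B_def pos_imp_zdiv_nonneg_iff)
  define l where "l = Max B"
  have l: "l \<in> B" "B \<subseteq> {0..l}"
  proof -
    have "B \<noteq> {}" using B0 by auto
    then show "l \<in> B" unfolding l_def using finB by (rule Max_in[rotated])
    show "B \<subseteq> {0..l}" using finB Bnn by (auto simp: l_def)
  qed
  have "0 < l"
  proof (rule ccontr)
    assume "\<not> 0 < l"
    then have "B \<subseteq> {0}" using l by fastforce
    then have "A \<subseteq> {c}" using AB by auto
    then show False using a1 by auto
  qed
  moreover have "\<forall>g>0. (\<forall>b\<in>B. g dvd b) \<longrightarrow> g = 1"
  proof (intro allI impI)
    fix g :: int assume g: "0 < g" "\<forall>b\<in>B. g dvd b"
    have "d * g dvd a - c" if "a \<in> A" for a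
    proof -
      have "g dvd (a - c) div d" using g that by (auto simp: B_def)
      then have "d * g dvd d * ((a - c) div d)" by simp
      then show ?thesis using dd[OF that] by simp
    qed
    then have "d * g dvd d" unfolding d_def[symmetric] by (subst d_def) (auto intro!: Gcd_greatest)
    then show "g = 1" using d g by (simp add: zdvd1_eq)
  qed
  moreover have "card B = card A" using AB inj by (simp add: card_image)
  moreover have "A + A = (\<lambda>x. (c + c) + d * x) ` (B + B)"
  proof (intro equalityI subsetI)
    fix x assume "x \<in> A + A"
    then obtain a' b' where "a' \<in> A" "b' \<in> A" "x = a' + b'" by (elim set_plus_elim)
    moreover obtain a b where "a \<in> B" "b \<in> B" "a' = c + d * a" "b' = c + d * b"
      using calculation AB by blast
    ultimately have "a \<in> B" "b \<in> B" "x = (c + d * a) + (c + d * b)" by simp_all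
    moreover have "(c + d * a) + (c + d * b) = (c + c) + d * (a + b)" by (simp add: algebra_simps)
    ultimately have "x = (c + c) + d * (a + b)" "a + b \<in> B + B" by (simp_all only: set_plus_intro)
    then show "x \<in> (\<lambda>x. (c + c) + d * x) ` (B + B)" by (rule image_eqI)
  next
    fix x assume "x \<in> (\<lambda>x. (c + c) + d * x) ` (B + B)"
    then obtain a b where "a \<in> B" "b \<in> B" "x = (c + c) + d * (a + b)" by (auto simp: set_plus_def)
    moreover have "(c + c) + d * (a + b) = (c + d * a) + (c + d * b)" by (simp add: algebra_simps)
    moreover have "c + d * a \<in> A" "c + d * b \<in> A" using calculation(1,2) AB by blast+
    ultimately show "x \<in> A + A" by (simp only: set_plus_intro)
  qed
  then have "card (B + B) = card (A + A)" using inj by (simp add: card_image)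
  ultimately show ?thesis using that[OF d AB finB B0 l] by blast
qed

lemma covered_by_long_progression:
  fixes A :: "int set"
  assumes fin: "finite A" and two: "2 \<le> card A"
    and small: "real (card (A + A)) \<le> 2.835 * real (card A) - 7"
  obtains c d where "0 < d" "A \<subseteq> (\<lambda>i. c + d * i) ` {0..85 * int (card A)}"
proof -
  obtain c d B l where B: "0 < d" "A = (\<lambda>b. c + d * b) ` B" "finite B" "0 \<in> B" "l \<in> B" "B \<subseteq> {0..l}" "0 < l"
    "\<forall>g>0. (\<forall>b\<in>B. g dvd b) \<longrightarrow> g = 1" "card B = card A" "card (B + B) = card (A + A)"
    by (rule int_set_normal_form[OF fin two]) (rule that; assumption)
  have "l \<le> 85 * int (card B)"
    using B small by (intro length_le_of_small_doubling) auto
  then have "B \<subseteq> {0..85 * int (card A)}" using B(6,9) by auto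
  then show ?thesis using that[of d c] B(1,2) by blast
qed

lemma covered_by_short_progression:
  fixes A :: "int set"
  assumes fin: "finite A" and two: "2 \<le> card A"
    and small: "2 * card (A + A) + 3 < 5 * card A"
  obtains c d where "0 < d" "A \<subseteq> (\<lambda>i. c + d * i) ` {0..int (card (A + A)) - int (card A)}"
proof -
  obtain c d B l where B: "0 < d" "A = (\<lambda>b. c + d * b) ` B" "finite B" "0 \<in> B" "l \<in> B" "B \<subseteq> {0..l}" "0 < l"
    "\<forall>g>0. (\<forall>b\<in>B. g dvd b) \<longrightarrow> g = 1" "card B = card A" "card (B + B) = card (A + A)"
    by (rule int_set_normal_form[OF fin two]) (rule that; assumption)
  have "l + int (card B) \<le> int (card (B + B))"
    using B small by (intro length_le_of_very_small_doubling) auto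
  then have "B \<subseteq> {0..int (card (A + A)) - int (card A)}" using B(6,9,10) by auto
  then show ?thesis using that[of d c] B(1,2) by blast
qed

section \<open>Exponential sums\<close>

lemma cis_eq_1_iff_int: "cis (2 * pi * x) = 1 \<longleftrightarrow> x \<in> \<int>"
proof
  assume "cis (2 * pi * x) = 1"
  then have "cos (2 * pi * x) = 1" by (simp add: complex_eq_iff)
  then obtain n where "2 * pi * x = real_of_int n * 2 * pi" by (auto simp: cos_one_2pi_int)
  then show "x \<in> \<int>" by (simp add: field_simps)
next
  assume "x \<in> \<int>"
  then show "cis (2 * pi * x) = 1" by (auto simp: Ints_def cis_multiple_2pi)
qed

lemma sum_cis_residues:
  fixes p :: nat and t :: int
  assumes p: "0 < p"
  shows "(\<Sum>d<p. cis (2 * pi * (real d * t / p))) = (if int p dvd t then of_nat p else 0)"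
proof -
  define w where "w = cis (2 * pi * (t / p))"
  have wd: "cis (2 * pi * (real d * t / p)) = w ^ d" for d
    unfolding w_def Complex.DeMoivre by (rule arg_cong[of _ _ cis]) simp
  have iff: "t / p \<in> \<int> \<longleftrightarrow> int p dvd t"
  proof
    assume "real_of_int t / real p \<in> \<int>"
    then obtain n where "real_of_int t / real p = real_of_int n" by (auto simp: Ints_def)
    then have "real_of_int t = real_of_int (n * int p)" using p by (simp add: field_simps)
    then show "int p dvd t" by (metis dvd_triv_right of_int_eq_iff)
  next
    assume "int p dvd t" then show "real_of_int t / real p \<in> \<int>" using p by auto
  qed
  have "w ^ p = cis (2 * pi * t)" using p by (simp add: w_def Complex.DeMoivre)
  then have wp: "w ^ p = 1" using cis_eq_1_iff_int[of "t"] by simp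
  show ?thesis
  proof (cases "int p dvd t")
    case True
    then have "w = 1" using iff cis_eq_1_iff_int[of "t / p"] by (simp add: w_def)
    then show ?thesis using True unfolding wd by simp
  next
    case False
    then have "w \<noteq> 1" using iff cis_eq_1_iff_int[of "t / p"] by (simp add: w_def)
    then show ?thesis using False wp unfolding wd by (simp add: geometric_sum)
  qed
qed

text \<open>Summing over indices instead of residues makes multiplicities count. With pairs as
  indices and their sum as \<open>f\<close>, the exponential sum factors and the right-hand side
  counts additive quadruples.\<close>

lemma parseval_residues:
  fixes f :: "'a \<Rightarrow> int" and p :: nat
  assumes p: "0 < p" and fin: "finite I"
  shows "(\<Sum>d<p. (cmod (\<Sum>i\<in>I. cis (2 * pi * (real d * f i / p))))\<^sup>2)
    = real p * real (card {(i, j) \<in> I \<times> I. f i mod int p = f j mod int p})"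
proof -
  have sq: "complex_of_real ((cmod (\<Sum>i\<in>I. cis (2 * pi * (real d * f i / p))))\<^sup>2)
     = (\<Sum>(i, j)\<in>I \<times> I. cis (2 * pi * (real d * (f i - f j) / p)))" for d
  proof -
    have "complex_of_real ((cmod (\<Sum>i\<in>I. cis (2 * pi * (real d * f i / p))))\<^sup>2)
      = (\<Sum>i\<in>I. cis (2 * pi * (real d * f i / p))) * (\<Sum>j\<in>I. cis (- (2 * pi * (real d * f j / p))))"
      unfolding complex_norm_square by (simp add: cis_cnj)
    also have "\<dots> = (\<Sum>(i, j)\<in>I \<times> I. cis (2 * pi * (real d * f i / p)) * cis (- (2 * pi * (real d * f j / p))))"
      by (simp add: sum_product sum.cartesian_product)
    also have "\<dots> = (\<Sum>(i, j)\<in>I \<times> I. cis (2 * pi * (real d * (f i - f j) / p)))"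
      by (intro sum.cong refl) (auto simp: cis_mult diff_divide_distrib right_diff_distrib)
    finally show ?thesis .
  qed
  have "complex_of_real (\<Sum>d<p. (cmod (\<Sum>i\<in>I. cis (2 * pi * (real d * f i / p))))\<^sup>2)
     = (\<Sum>d<p. \<Sum>(i, j)\<in>I \<times> I. cis (2 * pi * (real d * (f i - f j) / p)))"
    by (simp only: of_real_sum sq)
  also have "\<dots> = (\<Sum>(i, j)\<in>I \<times> I. \<Sum>d<p. cis (2 * pi * (real d * (f i - f j) / p)))"
    by (subst sum.swap) (simp add: case_prod_unfold)
  also have "\<dots> = (\<Sum>(i, j)\<in>I \<times> I. if f i mod int p = f j mod int p then of_nat p else 0)"
    using sum_cis_residues[OF p, of "f _ - f _"] by (intro sum.cong refl) (auto simp: mod_eq_dvd_iff)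
  also have "\<dots> = (\<Sum>x\<in>{(i, j) \<in> I \<times> I. f i mod int p = f j mod int p}. of_nat p)"
    using fin by (intro sum.mono_neutral_cong_right) (auto split: if_splits)
  also have "\<dots> = complex_of_real (real p * real (card {(i, j) \<in> I \<times> I. f i mod int p = f j mod int p}))"
    by simp
  finally show ?thesis by (simp only: of_real_eq_iff)
qed

text \<open>Split \<open>cos \<theta>\<close> into its level sets: for \<open>u \<in> [0, 1]\<close>, the points with \<open>Re z \<ge> u\<close> lie in both, and
  those with \<open>\<bar>Re z\<bar> < u\<close> in at least one, of the half planes orthogonal to
  \<open>(\<surd>(1 - u\<^sup>2), \<plusminus> u)\<close>.\<close>

lemma half_plane_many_Re:
  fixes z :: "'a \<Rightarrow> complex"
  assumes fin: "finite I" and unit: "\<And>i. i \<in> I \<Longrightarrow> cmod (z i) = 1"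
  shows "\<exists>w. cmod w = 1 \<and> (\<Sum>i\<in>I. Re (z i)) + real (card I) \<le> 2 * real (card {i \<in> I. 0 \<le> Re (z i * w)})"
proof -
  \<comment> \<open>On [0, 1] the signed level indicator \<open>g c\<close> integrates to
    \<open>c\<close> whenever |c| <= 1.\<close>
  define g where "g c u = (if u \<le> c then 1 else 0) - (if u \<le> - c then (1::real) else 0)" for c u :: real
  have pos: "((\<lambda>u. if u \<le> c then 1 else 0) has_integral max c 0) {0..1}" if "c \<le> 1" for c :: real
  proof (cases "0 \<le> c")
    case True
    have "((\<lambda>u. 1::real) has_integral c) {0..c}" using has_integral_const_real[of "1::real" 0 c] True by simp
    then have "((\<lambda>u. if u \<in> {0..c} then 1 else 0::real) has_integral c) {0..1}"
      using that by (subst has_integral_restrict) auto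
    then show ?thesis using True by (auto intro: has_integral_eq[rotated])
  next
    case False
    have "((\<lambda>u. if u \<le> c then 1 else 0::real) has_integral 0) {0..1}"
      using False by (intro has_integral_is_0) auto
    then show ?thesis using False by simp
  qed
  have int: "(g c has_integral c) {0..1}" if "\<bar>c\<bar> \<le> 1" for c
  proof -
    have "c \<le> 1" "- c \<le> 1" using that by linarith+
    from has_integral_diff[OF pos[OF this(1)] pos[OF this(2)]] show ?thesis
      by (simp add: g_def[abs_def] max_def split: if_splits)
  qed
  have Re1: "\<bar>Re (z i)\<bar> \<le> 1" if "i \<in> I" for i using abs_Re_le_cmod[of "z i"] unit[OF that] by simp
  define F where "F u = (\<Sum>i\<in>I. g (Re (z i)) u)" for u
  have F_int: "(F has_integral (\<Sum>i\<in>I. Re (z i))) {0..1}"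
    unfolding F_def using fin int Re1 by (intro has_integral_sum) auto
  have Fu: "F u = real (card {i \<in> I. u \<le> Re (z i)}) - real (card {i \<in> I. u \<le> - Re (z i)})" for u
    unfolding F_def g_def sum_subtractf using fin by (simp only: sum.inter_filter[symmetric]) simp
  have Fmem: "F u \<in> (\<lambda>(a, b). real a - real b) ` ({..card I} \<times> {..card I})" for u
  proof (rule image_eqI)
    show "F u = (\<lambda>(a, b). real a - real b) (card {i \<in> I. u \<le> Re (z i)}, card {i \<in> I. u \<le> - Re (z i)})"
      by (simp add: Fu)
  qed (use fin in \<open>auto intro!: card_mono\<close>)
  \<comment> \<open>As a difference of two cardinalities, \<open>F\<close> takes finitely many
    values, so it attains a maximum, which is at least its mean.\<close>
  have "F ` {0..1} \<subseteq> (\<lambda>(a, b). real a - real b) ` ({..card I} \<times> {..card I})"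
    by (rule image_subsetI) (rule Fmem)
  then have finF: "finite (F ` {0..1})" by (rule finite_subset) simp
  moreover have "F ` {0..1} \<noteq> {}" by simp
  ultimately obtain u where u01: "u \<in> {0..1}" "F u = Max (F ` {0..1})" using Max_in by (metis imageE)
  have "(\<Sum>i\<in>I. Re (z i)) \<le> F u * (1 - 0)"
  proof (rule has_integral_le[OF F_int])
    show "((\<lambda>_::real. F u) has_integral F u * (1 - 0)) {0..1}" using has_integral_const_real[of "F u" 0 1] by simp
    show "F x \<le> F u" if "x \<in> {0..1}" for x using that finF u01 by auto
  qed
  then have "\<exists>u\<in>{0..1}. (\<Sum>i\<in>I. Re (z i)) \<le> (\<Sum>i\<in>I. g (Re (z i)) u)"
    using u01(1) unfolding F_def by auto
  then obtain u where u: "0 \<le> u" "u \<le> 1" "(\<Sum>i\<in>I. Re (z i)) \<le> (\<Sum>i\<in>I. g (Re (z i)) u)" by auto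
  define v where "v = sqrt (1 - u\<^sup>2)"
  have v: "0 \<le> v" "u\<^sup>2 + v\<^sup>2 = 1" using u by (auto simp: v_def power_le_one_iff abs_le_square_iff)
  define w1 w2 where "w1 = Complex v (- u)" and "w2 = Complex v u"
  have unitw: "cmod w1 = 1" "cmod w2 = 1" using v by (simp_all add: w1_def w2_def cmod_def add.commute)
  define N where "N w i = (if 0 \<le> Re (z i * w) then 1 else (0::real))" for w i
  have pt: "1 + g (Re (z i)) u \<le> N w1 i + N w2 i" if "i \<in> I" for i
  proof -
    define c s where "c = Re (z i)" and "s = Im (z i)"
    have cs: "c\<^sup>2 + s\<^sup>2 = 1" using unit[OF that] by (simp add: cmod_def c_def s_def)
    have R: "Re (z i * w1) = c * v + s * u" "Re (z i * w2) = c * v - s * u"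
      by (simp_all add: w1_def w2_def c_def s_def)
    have gN: "g (Re (z i)) u = (if u \<le> c then 1 else 0) - (if u \<le> - c then 1 else 0)"
      "N w1 i = (if 0 \<le> c * v + s * u then 1 else 0)" "N w2 i = (if 0 \<le> c * v - s * u then 1 else 0)"
      by (simp_all only: g_def N_def R c_def)
    show ?thesis
    proof (cases "u \<le> c")
      case True
      have "u\<^sup>2 \<le> c\<^sup>2" using True u by (intro power_mono) auto
      then have "s\<^sup>2 \<le> v\<^sup>2" using cs v by linarith
      then have sv: "\<bar>s\<bar> \<le> v" using v by (simp add: abs_le_square_iff[symmetric] abs_of_nonneg)
      have "\<bar>s\<bar> * u \<le> v * c" using sv True u v by (intro mult_mono) auto
      then have "\<bar>s * u\<bar> \<le> c * v" using u by (simp add: abs_mult mult.commute)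
      then have "0 \<le> c * v + s * u" "0 \<le> c * v - s * u" by linarith+
      then show ?thesis by (simp add: gN)
    next
      case F: False
      show ?thesis
      proof (cases "u \<le> - c")
        case True
        then show ?thesis using F by (simp add: gN)
      next
        case False
        then have "\<bar>c\<bar> \<le> u" using F by linarith
        then have "c\<^sup>2 \<le> u\<^sup>2" using u by (simp add: abs_le_square_iff[symmetric] abs_of_nonneg)
        then have "v\<^sup>2 \<le> s\<^sup>2" using cs v by linarith
        then have "v \<le> \<bar>s\<bar>" using v by (simp add: abs_le_square_iff[symmetric] abs_of_nonneg)
        then have "\<bar>c\<bar> * v \<le> u * \<bar>s\<bar>" using \<open>\<bar>c\<bar> \<le> u\<close> u v by (intro mult_mono) auto
        then have "\<bar>c * v\<bar> \<le> \<bar>s * u\<bar>" using u v by (simp add: abs_mult mult.commute)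
        then have "0 \<le> c * v + s * u \<or> 0 \<le> c * v - s * u" by linarith
        then show ?thesis using F False by (auto simp: gN)
      qed
    qed
  qed
  have cardN: "(\<Sum>i\<in>I. N w i) = real (card {i \<in> I. 0 \<le> Re (z i * w)})" for w
    using fin by (simp add: N_def sum.inter_filter[symmetric])
  have "(\<Sum>i\<in>I. Re (z i)) + real (card I) \<le> (\<Sum>i\<in>I. 1 + g (Re (z i)) u)"
    using u by (simp add: sum.distrib)
  also have "\<dots> \<le> (\<Sum>i\<in>I. N w1 i + N w2 i)" using pt by (rule sum_mono)
  also have "\<dots> = real (card {i \<in> I. 0 \<le> Re (z i * w1)}) + real (card {i \<in> I. 0 \<le> Re (z i * w2)})"
    by (simp add: sum.distrib cardN)
  finally have "(\<Sum>i\<in>I. Re (z i)) + real (card I) \<le> 2 * real (card {i \<in> I. 0 \<le> Re (z i * w1)}) \<or>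
    (\<Sum>i\<in>I. Re (z i)) + real (card I) \<le> 2 * real (card {i \<in> I. 0 \<le> Re (z i * w2)})" by linarith
  then show ?thesis using unitw by blast
qed

text \<open>Freiman's half circle lemma: rotating all points by the conjugate phase of their sum
  makes the sum of the real parts equal to its modulus.\<close>

lemma half_plane_many:
  fixes z :: "'a \<Rightarrow> complex"
  assumes fin: "finite I" and unit: "\<And>i. i \<in> I \<Longrightarrow> cmod (z i) = 1"
  obtains w where "cmod w = 1" "cmod (\<Sum>i\<in>I. z i) + real (card I) \<le> 2 * real (card {i \<in> I. 0 \<le> Re (z i * w)})"
proof -
  define S where "S = (\<Sum>i\<in>I. z i)"
  define r where "r = (if S = 0 then 1 else cnj (S / cmod S))"
  have r: "cmod r = 1" by (simp add: r_def norm_divide)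
  have Sr: "Re (S * r) = cmod S"
  proof (cases "S = 0")
    case False
    have "S * r = S * cnj S / cmod S" using False by (simp add: r_def)
    also have "\<dots> = cmod S" using False by (simp add: complex_norm_square[symmetric] power2_eq_square)
    finally show ?thesis by simp
  qed simp
  obtain w where w: "cmod w = 1"
    "(\<Sum>i\<in>I. Re (z i * r)) + real (card I) \<le> 2 * real (card {i \<in> I. 0 \<le> Re (z i * r * w)})"
    using half_plane_many_Re[OF fin, of "\<lambda>i. z i * r"] unit r by (auto simp: norm_mult)
  have "(\<Sum>i\<in>I. Re (z i * r)) = cmod S"
    using Sr by (simp only: Re_sum[symmetric] sum_distrib_right[symmetric] S_def)
  then show ?thesis using that[of "r * w"] w r by (simp add: S_def norm_mult mult.assoc)
qed

text \<open>The half circle begins at \<open>y\<close>, where the argument of the cosine is -pi/2,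
  and \<open>x\<close> is the next integer. Since \<open>p\<close> is odd, no residue is at distance
  exactly p/2 from \<open>x\<close>, so the interval is short enough for sums of two of its points
  not to wrap around.\<close>

lemma arc_subset_interval:
  fixes p :: nat and \<psi> :: real
  assumes p: "odd p"
  obtains x :: int where "\<And>t::int. 0 \<le> cos (2 * pi * (t / p) + \<psi>) \<Longrightarrow> 2 * ((t - x) mod int p) < int p"
proof -
  have p0: "0 < p" using p by (rule odd_pos)
  define y where "y = - real p * (\<psi> / (2 * pi) + 1 / 4)"
  define x where "x = \<lceil>y\<rceil>"
  have "2 * ((t - x) mod int p) < int p" if cos: "0 \<le> cos (2 * pi * (t / p) + \<psi>)" for t :: int
  proof (rule ccontr)
    define u where "u = (t - x) mod int p"
    define q where "q = (t - x) div int p"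
    assume "\<not> 2 * ((t - x) mod int p) < int p"
    then have "int p \<le> 2 * u" by (simp add: u_def)
    then have u1: "int p < 2 * u" using p by (metis even_mult_iff even_of_nat even_numeral order_le_less)
    have u2: "u < int p" using p0 by (simp add: u_def)
    have t: "t = x + u + q * int p" by (simp add: u_def q_def)
    define s where "s = real_of_int x + real_of_int u - y"
    have xy: "y \<le> real_of_int x" "real_of_int x < y + 1" unfolding x_def by linarith+
    have "real p < 2 * real_of_int u" using u1 by linarith
    then have s1: "real p < 2 * s" using xy by (simp add: s_def)
    have "real_of_int u + 1 \<le> real p" using u2 by linarith
    then have s2: "s < real p" using xy by (simp add: s_def)
    have "2 * pi * (t / p) + \<psi> = (2 * pi * (s / p) - pi / 2) + 2 * pi * of_int q"
      using p0 by (simp add: t s_def y_def field_simps)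
    then have "cos (2 * pi * (t / p) + \<psi>) = cos ((2 * pi * (s / p) - pi / 2) + 2 * pi * of_int q)" by (rule arg_cong)
    also have "\<dots> = cos (2 * pi * (s / p) - pi / 2)"
      by (simp only: cos_add cos_int_2pin sin_int_2pin mult_1_right mult_zero_right diff_zero)
    also have "\<dots> = sin (2 * pi * (s / p))" by (simp add: cos_diff)
    also have "\<dots> < 0"
    proof (rule sin_lt_zero)
      have "1 < 2 * (s / p)" using s1 p0 by (simp add: field_simps)
      then have "pi * 1 < pi * (2 * (s / p))" by (intro mult_strict_left_mono) auto
      then show "pi < 2 * pi * (s / p)" by (simp add: algebra_simps)
      have "s / p < 1" using s2 p0 by (simp add: field_simps)
      then have "2 * pi * (s / p) < 2 * pi * 1" by (intro mult_strict_left_mono) auto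
      then show "2 * pi * (s / p) < 2 * pi" by simp
    qed
    finally show False using cos by simp
  qed
  then show ?thesis by (rule that)
qed

section \<open>Additive quadruples and the large Fourier coefficient\<close>

lemma card_pairs_of_pairs:
  fixes I J :: "'x set"
  assumes "finite I" "finite J"
  shows "card {(x, y) \<in> (I \<times> J) \<times> (I \<times> J). P (fst x) (snd x) (fst y) (snd y)}
    = (\<Sum>(a, a')\<in>I \<times> I. card {(c, c') \<in> J \<times> J. P a c a' c'})"
proof -
  let ?S = "SIGMA q:I \<times> I. {(c, c') \<in> J \<times> J. P (fst q) c (snd q) c'}"
  let ?T = "{(x, y) \<in> (I \<times> J) \<times> (I \<times> J). P (fst x) (snd x) (fst y) (snd y)}"
  define h where "h q = ((fst (fst q), fst (snd q)), (snd (fst q), snd (snd q)))" for q :: "('x \<times> 'x) \<times> ('x \<times> 'x)"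
  have "bij_betw h ?S ?T"
  proof (rule bij_betw_byWitness[where f' = h])
    show "h ` ?S \<subseteq> ?T"
    proof (rule image_subsetI)
      fix q assume "q \<in> ?S"
      then obtain a a' c c' where "q = ((a, a'), (c, c'))" "a \<in> I" "a' \<in> I" "c \<in> J" "c' \<in> J" "P a c a' c'" by auto
      then show "h q \<in> ?T" by (simp add: h_def)
    qed
    show "h ` ?T \<subseteq> ?S"
    proof (rule image_subsetI)
      fix q assume "q \<in> ?T"
      then obtain a a' c c' where "q = ((a, c), (a', c'))" "a \<in> I" "a' \<in> I" "c \<in> J" "c' \<in> J" "P a c a' c'" by auto
      then show "h q \<in> ?S" by (simp add: h_def)
    qed
  qed (simp_all add: h_def)
  then have "card {(x, y) \<in> (I \<times> J) \<times> (I \<times> J). P (fst x) (snd x) (fst y) (snd y)} = card ?S"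
    by (rule bij_betw_same_card[symmetric])
  also have "\<dots> = (\<Sum>q\<in>I \<times> I. card {(c, c') \<in> J \<times> J. P (fst q) c (snd q) c'})"
  proof (rule card_SigmaI)
    show "\<forall>q\<in>I \<times> I. finite {(c, c') \<in> J \<times> J. P (fst q) c (snd q) c'}"
      using assms by (auto intro: finite_subset[of _ "J \<times> J"])
  qed (use assms in auto)
  finally show ?thesis by (simp add: case_prod_unfold)
qed

text \<open>Cauchy-Schwarz over the fibres of \<open>f\<close>, whose squared sizes add up to the
  number of collisions.\<close>

lemma card_collisions_ge:
  assumes "finite I"
  shows "(real (card I))\<^sup>2 \<le> real (card (f ` I)) * real (card {(i, j) \<in> I \<times> I. f i = f j})"
proof -
  let ?c = "\<lambda>r. card {i \<in> I. f i = r}"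
  have "{(i, j) \<in> I \<times> I. f i = f j} = (\<Union>r\<in>f ` I. {i \<in> I. f i = r} \<times> {i \<in> I. f i = r})" by auto
  moreover have "card (\<Union>r\<in>f ` I. {i \<in> I. f i = r} \<times> {i \<in> I. f i = r}) = (\<Sum>r\<in>f ` I. card ({i \<in> I. f i = r} \<times> {i \<in> I. f i = r}))"
    using assms by (intro card_UN_disjoint) auto
  ultimately have "real (card {(i, j) \<in> I \<times> I. f i = f j}) = (\<Sum>r\<in>f ` I. (real (?c r))\<^sup>2)"
    by (simp add: card_cartesian_product power2_eq_square)
  moreover have "real (card I) = (\<Sum>r\<in>f ` I. real (?c r))"
    using card_eq_sum_fibres[OF assms, of f] by simp
  ultimately show ?thesis
    using sum_squared_le_sum_of_squares[of "\<lambda>r. real (?c r)" "f ` I"] by (simp add: mult.commute)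
qed

text \<open>The number \<open>Q\<close> of solutions of \<open>a + c = a' + c'\<close> with \<open>a, a' \<in> A\<close> and \<open>c, c' \<in> A + A\<close> is
  large: for fixed \<open>a, a'\<close> and \<open>X = A \<inter> (A + a' - a)\<close>, each element of \<open>A + X\<close> gives one (Katz and
  Koester), and \<open>|A + X|\<close> is nearly at least \<open>|A| + |X| - 1\<close>.\<close>

lemma card_additive_quadruples_ge:
  fixes p :: nat and A :: "int set" and K :: real
  defines "C \<equiv> (\<lambda>x. x mod int p) ` (A + A)"
  defines "Q \<equiv> card {(x, y) \<in> (A \<times> C) \<times> (A \<times> C). (fst x + snd x) mod int p = (fst y + snd y) mod int p}"
  assumes p: "prime p" and A: "A \<subseteq> {0..<int p}" "A \<noteq> {}" and K: "0 \<le> K" "K \<le> 1"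
    and small: "real (nres (int p) (A + A)) < (1 - K) * p"
  shows "nres (int p) (A + A) * ((real (card A))^3 - K * (real (card A))\<^sup>2) + K * (real (card A))^4
     \<le> nres (int p) (A + A) * real Q"
proof -
  define n m where "n = real (card A)" and "m = real (nres (int p) (A + A))"
  have p0: "0 < int p" using p prime_gt_0_nat by simp
  have finA: "finite A" using A finite_subset by blast
  have finC: "finite C" unfolding C_def using p0 by (rule finite_residues)
  define X where "X a a' = {b \<in> A. \<exists>b'\<in>A. (a + b) mod int p = (a' + b') mod int p}" for a a'
  have fibre: "n + K * (real (card (X a a')) - 1) \<le> real (card {(c, c') \<in> C \<times> C. (a + c) mod int p = (a' + c') mod int p})"
    if a: "a \<in> A" "a' \<in> A" for a a'
  proof -
    have XA: "X a a' \<subseteq> A" by (auto simp: X_def)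
    have "a' \<in> X a a'" using a by (auto simp: X_def add.commute)
    then have Xne: "X a a' \<noteq> {}" by auto
    have "nres (int p) (A + X a a') \<le> nres (int p) (A + A)" using p0 XA by (intro nres_mono set_plus_mono2) auto
    then have "real (nres (int p) (A + X a a')) < (1 - K) * p" using small by linarith
    from nres_add_lower_prime[OF p K(1) A(2) Xne this]
    have 1: "n + K * (real (card (X a a')) - 1) \<le> real (nres (int p) (A + X a a'))"
      using nres_eq_card[OF A(1)] nres_eq_card[of "X a a'" "int p"] XA A(1) by (simp add: n_def)
    \<comment> \<open>Modulo \<open>p\<close>, an element \<open>c = y + b\<close> of
      \<open>A + X a a'\<close> is paired with \<open>c + a - a' = y + b'\<close>, which is again in
      \<open>C\<close>.\<close>
    define F where "F c = (c, (c + (a - a')) mod int p)" for c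
    have "F ` (\<lambda>x. x mod int p) ` (A + X a a') \<subseteq> {(c, c') \<in> C \<times> C. (a + c) mod int p = (a' + c') mod int p}"
    proof (rule image_subsetI, erule imageE, elim set_plus_elim)
      fix c x y b assume *: "c = x mod int p" "y \<in> A" "b \<in> X a a'" "x = y + b"
      then obtain b' where b: "b \<in> A" "b' \<in> A" "(a + b) mod int p = (a' + b') mod int p" by (auto simp: X_def)
      have "y + b \<in> A + A" "y + b' \<in> A + A" using * b by (simp_all add: set_plus_intro)
      then have "c \<in> C" and yb': "(y + b') mod int p \<in> C" using * by (auto simp: C_def)
      moreover have "(c + (a - a')) mod int p = (y + b') mod int p"
      proof -
        have "int p dvd (a + b) - (a' + b')" using b(3) by (simp only: mod_eq_dvd_iff)
        moreover have "(y + b + (a - a')) - (y + b') = (a + b) - (a' + b')" by simp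
        ultimately have "(y + b + (a - a')) mod int p = (y + b') mod int p" by (simp only: mod_eq_dvd_iff)
        then show ?thesis using * by (simp add: mod_simps)
      qed
      moreover have "(a + c) mod int p = (a' + (c + (a - a')) mod int p) mod int p"
        by (simp add: mod_add_right_eq add.commute)
      ultimately show "F c \<in> {(c, c') \<in> C \<times> C. (a + c) mod int p = (a' + c') mod int p}" by (simp add: F_def)
    qed
    moreover have "inj_on F Y" for Y by (auto simp: F_def inj_on_def)
    moreover have "finite {(c, c') \<in> C \<times> C. (a + c) mod int p = (a' + c') mod int p}"
      using finC by (auto intro: finite_subset[of _ "C \<times> C"])
    ultimately have "nres (int p) (A + X a a') \<le> card {(c, c') \<in> C \<times> C. (a + c) mod int p = (a' + c') mod int p}"
      unfolding nres_def using card_inj_on_le by blast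
    with 1 show ?thesis by linarith
  qed
  have fibre2: "card {(b, b') \<in> A \<times> A. (a + b) mod int p = (a' + b') mod int p} \<le> card (X a a')" for a a'
  proof (rule card_inj_on_le)
    show "inj_on fst {(b, b') \<in> A \<times> A. (a + b) mod int p = (a' + b') mod int p}"
    proof (rule inj_onI)
      fix x y assume xy: "x \<in> {(b, b') \<in> A \<times> A. (a + b) mod int p = (a' + b') mod int p}"
        "y \<in> {(b, b') \<in> A \<times> A. (a + b) mod int p = (a' + b') mod int p}" "fst x = fst y"
      then have "(a' + snd x) mod int p = (a' + snd y) mod int p" "snd x \<in> A" "snd y \<in> A" by (auto simp: case_prod_unfold)
      then have "int p dvd snd x - snd y" by (simp add: mod_eq_dvd_iff)
      moreover have "snd x mod int p = snd x" "snd y mod int p = snd y" using \<open>snd x \<in> A\<close> \<open>snd y \<in> A\<close> A(1) by auto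
      ultimately show "x = y" using xy(3) by (metis mod_eq_dvd_iff prod_eqI)
    qed
  qed (use finA in \<open>auto simp: X_def\<close>)
  \<comment> \<open>\<open>E\<close> is the additive energy of \<open>A\<close>. The sizes of the
    sets \<open>X a a'\<close> add up to at least \<open>E\<close>, and Cauchy-Schwarz gives
    \<open>E >= n^4 / m\<close>; the factor \<open>m\<close> in the claim avoids this
    division.\<close>
  define E where "E = card {(x, y) \<in> (A \<times> A) \<times> (A \<times> A). (fst x + snd x) mod int p = (fst y + snd y) mod int p}"
  have "E = (\<Sum>(a, a')\<in>A \<times> A. card {(b, b') \<in> A \<times> A. (a + b) mod int p = (a' + b') mod int p})"
    unfolding E_def by (rule card_pairs_of_pairs[OF finA finA])
  also have "\<dots> \<le> (\<Sum>(a, a')\<in>A \<times> A. card (X a a'))" using fibre2 by (intro sum_mono) auto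
  finally have EX: "real E \<le> (\<Sum>(a, a')\<in>A \<times> A. real (card (X a a')))" by (simp add: case_prod_unfold flip: of_nat_sum)
  have "n^3 - K * n\<^sup>2 + K * real E \<le> n^3 - K * n\<^sup>2 + K * (\<Sum>(a, a')\<in>A \<times> A. real (card (X a a')))"
    using EX K(1) by (simp add: mult_left_mono)
  also have "\<dots> = (\<Sum>(a, a')\<in>A \<times> A. n + K * (real (card (X a a')) - 1))"
    by (simp add: case_prod_unfold sum.distrib sum_subtractf right_diff_distrib card_cartesian_product n_def
        power2_eq_square power3_eq_cube sum_distrib_left)
  also have "\<dots> \<le> (\<Sum>(a, a')\<in>A \<times> A. real (card {(c, c') \<in> C \<times> C. (a + c) mod int p = (a' + c') mod int p}))"
    using fibre by (intro sum_mono) auto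
  also have "\<dots> = real Q"
    unfolding Q_def by (subst card_pairs_of_pairs[OF finA finC]) (simp add: case_prod_unfold)
  finally have Q: "n^3 - K * n\<^sup>2 + K * real E \<le> real Q" .
  have "(\<lambda>x. (fst x + snd x) mod int p) ` (A \<times> A) = C"
    by (auto simp: C_def set_plus_def image_iff) (metis fst_conv snd_conv mem_Sigma_iff)+
  then have "(real (card (A \<times> A)))\<^sup>2 \<le> real (card C) * real E"
    using card_collisions_ge[of "A \<times> A" "\<lambda>x. (fst x + snd x) mod int p"] finA by (simp add: E_def)
  then have "n^4 \<le> m * real E" by (simp add: card_cartesian_product C_def n_def m_def nres_def power_mult_distrib flip: power_add power_mult)
  then have "K * n^4 \<le> K * (m * real E)" using K(1) by (rule mult_left_mono)
  moreover have "m * (n^3 - K * n\<^sup>2 + K * real E) \<le> m * real Q" using Q by (rule mult_left_mono) (simp add: m_def)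
  ultimately show ?thesis unfolding n_def[symmetric] m_def[symmetric] by (simp add: algebra_simps)
qed

text \<open>Let n = |A|, m = |2A|. If all nontrivial coefficients were below 3/4 n, Parseval would
  bound the number of quadruples by about 9/16 n^2 m, against a lower bound of about n^3 + n^4/m.
  For m = 2.48 n this contradicts 1/2.48 + 1/2.48^2 = 0.5658... > 0.5625.\<close>

lemma exists_large_fourier_coefficient:
  fixes p :: nat and A :: "int set"
  assumes p: "prime p" and A: "A \<subseteq> {0..<int p}"
    and small: "real (nres (int p) (A + A)) \<le> 2.48 * real (card A) - 7"
    and sparse: "real (card A) < real p / 10 ^ 10"
  obtains d :: nat where "0 < d" "d < p"
    "0.75 * real (card A) \<le> cmod (\<Sum>a\<in>A. cis (2 * pi * (real d * a / p)))"
proof (rule ccontr)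
  assume contra: "\<not> thesis"
  define n m where "n = real (card A)" and "m = real (nres (int p) (A + A))"
  have p0: "0 < p" using p prime_gt_0_nat by simp
  have m0: "0 \<le> m" by (simp add: m_def)
  have mn: "m \<le> 2.48 * n - 7" using small by (simp add: n_def m_def)
  then have n0: "0 < n" using m0 by simp
  then have Ane: "A \<noteq> {}" by (auto simp: n_def)
  have finA: "finite A" using A finite_subset by blast
  define C where "C = (\<lambda>x. x mod int p) ` (A + A)"
  have finC: "finite C" unfolding C_def using p0 by (intro finite_residues) simp
  have cC: "real (card C) = m" by (simp add: C_def m_def nres_def)
  have "A + A \<noteq> {}" using Ane set_plus_intro[of _ A _ A] by blast
  then have m1: "0 < m" using nres_pos[of "int p" "A + A"] p0 by (simp add: m_def)
  have no_large: "\<not> (0 < d \<and> d < p \<and> 0.75 * real (card A) \<le> cmod (\<Sum>a\<in>A. cis (2 * pi * (real d * a / p))))" for d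
    using contra that by blast
  define FA FC where "FA d = (\<Sum>a\<in>A. cis (2 * pi * (real d * a / p)))"
    and "FC d = (\<Sum>c\<in>C. cis (2 * pi * (real d * c / p)))" for d :: nat
  define Q where "Q = card {(x, y) \<in> (A \<times> C) \<times> (A \<times> C). (fst x + snd x) mod int p = (fst y + snd y) mod int p}"
  have prod: "(\<Sum>x\<in>A \<times> C. cis (2 * pi * (real d * (fst x + snd x) / p))) = FA d * FC d" for d
    unfolding FA_def FC_def sum_product sum.cartesian_product
    by (intro sum.cong refl) (auto simp: cis_mult add_divide_distrib distrib_left)
  have "(\<Sum>d<p. (cmod (FA d * FC d))\<^sup>2) = real p * real Q"
    using parseval_residues[OF p0, of "A \<times> C" "\<lambda>x. fst x + snd x"] finA finC
    unfolding Q_def prod by simp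
  then have pQ: "(\<Sum>d<p. (cmod (FA d))\<^sup>2 * (cmod (FC d))\<^sup>2) = real p * real Q"
    by (simp add: norm_mult power_mult_distrib)
  have "{(c, c') \<in> C \<times> C. c mod int p = c' mod int p} = (\<lambda>c. (c, c)) ` C" by (auto simp: C_def)
  then have "card {(c, c') \<in> C \<times> C. c mod int p = c' mod int p} = card C" by (simp add: card_image inj_on_def)
  then have pC: "(\<Sum>d<p. (cmod (FC d))\<^sup>2) = real p * m"
    using parseval_residues[OF p0 finC, of "\<lambda>c. c"] cC unfolding FC_def by simp
  have FA: "(cmod (FA d))\<^sup>2 \<le> 0.5625 * n\<^sup>2" if "0 < d" "d < p" for d
  proof -
    have "cmod (FA d) \<le> 0.75 * n" using no_large[of d] that by (simp add: FA_def n_def)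
    then have "(cmod (FA d))\<^sup>2 \<le> (0.75 * n)\<^sup>2" by (intro power_mono) auto
    then show ?thesis by (simp add: power_mult_distrib power2_eq_square)
  qed
  have cmod_le: "cmod (\<Sum>c\<in>S. cis (f c)) \<le> real (card S)" for S :: "int set" and f
    using sum_norm_le[of S "\<lambda>c. cis (f c)" "\<lambda>_. 1"] by simp
  have "{..<p} = insert 0 {1..<p}" using p0 by auto
  then have "real p * real Q = (cmod (FA 0))\<^sup>2 * (cmod (FC 0))\<^sup>2 + (\<Sum>d\<in>{1..<p}. (cmod (FA d))\<^sup>2 * (cmod (FC d))\<^sup>2)"
    using pQ by simp
  also have "\<dots> \<le> n\<^sup>2 * m\<^sup>2 + (\<Sum>d\<in>{1..<p}. 0.5625 * n\<^sup>2 * (cmod (FC d))\<^sup>2)"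
    using cmod_le FA cC by (intro add_mono mult_mono power_mono sum_mono) (auto simp: FA_def FC_def n_def)
  also have "(\<Sum>d\<in>{1..<p}. 0.5625 * n\<^sup>2 * (cmod (FC d))\<^sup>2) \<le> (\<Sum>d<p. 0.5625 * n\<^sup>2 * (cmod (FC d))\<^sup>2)"
    by (intro sum_mono2) auto
  also have "(\<Sum>d<p. 0.5625 * n\<^sup>2 * (cmod (FC d))\<^sup>2) = 0.5625 * n\<^sup>2 * (real p * m)"
    by (simp only: sum_distrib_left[symmetric] pC)
  finally have up: "real p * real Q \<le> n\<^sup>2 * m\<^sup>2 + 0.5625 * n\<^sup>2 * (real p * m)" by simp
  have pn: "10 ^ 10 * n < real p" using sparse by (simp add: n_def)
  \<comment> \<open>The term \<open>d = 0\<close> is at most \<open>n^2 m^2\<close>; sparsity bounds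
    it by \<open>0.0001 p n^2 m\<close>, which turns 0.5625 into 0.5626.\<close>
  then have mp: "m \<le> 0.0001 * real p" using mn n0 by simp
  have "n\<^sup>2 * m\<^sup>2 = n\<^sup>2 * m * m" by (simp add: power2_eq_square)
  also have "\<dots> \<le> n\<^sup>2 * m * (0.0001 * real p)" using mp m0 by (intro mult_left_mono) auto
  finally have "real p * real Q \<le> real p * (0.5626 * n\<^sup>2 * m)" using up by (simp add: algebra_simps)
  then have Q: "real Q \<le> 0.5626 * n\<^sup>2 * m" using p0 by simp
  have "m < (1 - 0.99) * real p" using mp pn n0 by simp
  then have "m * (n^3 - 0.99 * n\<^sup>2) + 0.99 * n^4 \<le> m * real Q"
    using card_additive_quadruples_ge[OF p A Ane, of "0.99"] by (simp add: n_def m_def Q_def C_def)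
  also have "\<dots> \<le> m * (0.5626 * n\<^sup>2 * m)" using Q m0 by (rule mult_left_mono)
  finally have "n\<^sup>2 * (m * (n - 0.99) + 0.99 * n\<^sup>2) \<le> n\<^sup>2 * (0.5626 * m\<^sup>2)"
    by (simp add: algebra_simps power2_eq_square power3_eq_cube power4_eq_xxxx)
  then have fin: "m * (n - 0.99) + 0.99 * n\<^sup>2 \<le> 0.5626 * m\<^sup>2" using n0 by simp
  \<comment> \<open>0.403 is just below 1/2.48, and \<open>0.403 + 0.99 * 0.403^2\<close>, about
    0.5638, still exceeds 0.5626.\<close>
  have "0.403 * m \<le> n - 0.99" using mn m0 by simp
  then have 1: "m * (0.403 * m) \<le> m * (n - 0.99)" using m0 by (rule mult_left_mono)
  have "0.403 * m \<le> n" using mn m0 by simp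
  then have "(0.403 * m)\<^sup>2 \<le> n\<^sup>2" using m0 by (intro power_mono) auto
  with 1 fin have "m\<^sup>2 * (0.403 + 0.99 * 0.403\<^sup>2 - 0.5626) \<le> 0" by (simp add: power2_eq_square algebra_simps)
  then show False using m1 by (simp add: power2_eq_square mult_le_0_iff)
qed

section \<open>Rectification modulo a prime\<close>

lemma nres_affine_set_plus:
  assumes "coprime q m"
  shows "nres m ((\<lambda>a. (q * a - z) mod m) ` X + (\<lambda>a. (q * a - z) mod m) ` Y) = nres m (X + Y)"
proof -
  let ?f = "\<lambda>a. (q * a - z) mod m"
  have "(\<lambda>x. x mod m) ` (?f ` X + ?f ` Y) = (\<lambda>x. x mod m) ` (\<lambda>s. q * s - 2 * z) ` (X + Y)"
  proof (intro equalityI subsetI)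
    fix t assume "t \<in> (\<lambda>x. x mod m) ` (?f ` X + ?f ` Y)"
    then obtain a b where ab: "a \<in> X" "b \<in> Y" "t = (?f a + ?f b) mod m" by (auto elim!: set_plus_elim)
    moreover have "(?f a + ?f b) mod m = (q * (a + b) - 2 * z) mod m" by (simp add: mod_add_eq algebra_simps)
    ultimately show "t \<in> (\<lambda>x. x mod m) ` (\<lambda>s. q * s - 2 * z) ` (X + Y)" by (auto intro: set_plus_intro)
  next
    fix t assume "t \<in> (\<lambda>x. x mod m) ` (\<lambda>s. q * s - 2 * z) ` (X + Y)"
    then obtain a b where ab: "a \<in> X" "b \<in> Y" "t = (q * (a + b) - 2 * z) mod m" by (auto elim!: set_plus_elim)
    moreover have "(?f a + ?f b) mod m = (q * (a + b) - 2 * z) mod m" by (simp add: mod_add_eq algebra_simps)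
    ultimately have "t = (?f a + ?f b) mod m" by simp
    moreover have "?f a + ?f b \<in> ?f ` X + ?f ` Y" using ab by (intro set_plus_intro) auto
    ultimately show "t \<in> (\<lambda>x. x mod m) ` (?f ` X + ?f ` Y)" by blast
  qed
  then have "nres m (?f ` X + ?f ` Y) = nres m ((\<lambda>s. q * s - 2 * z) ` (X + Y))" by (simp add: nres_def)
  also have "\<dots> = nres m (X + Y)"
  proof (rule nres_image_eq)
    fix x y :: int
    have "(q * x - 2 * z) - (q * y - 2 * z) = q * (x - y)" by (simp add: algebra_simps)
    then show "(q * x - 2 * z) mod m = (q * y - 2 * z) mod m \<longleftrightarrow> x mod m = y mod m"
      using assms by (simp only: mod_eq_dvd_iff coprime_commute coprime_dvd_mult_right_iff)
  qed
  finally show ?thesis .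
qed

lemma inj_on_affine_residues:
  fixes m :: int
  assumes "coprime q m" "A \<subseteq> {0..<m}"
  shows "inj_on (\<lambda>a. (q * a - z) mod m) A"
proof (rule inj_onI)
  fix x y assume xy: "x \<in> A" "y \<in> A" "(q * x - z) mod m = (q * y - z) mod m"
  then have "m dvd q * (x - y)" by (simp add: mod_eq_dvd_iff algebra_simps)
  then have "m dvd x - y" using assms(1) by (simp add: coprime_dvd_mult_right_iff coprime_commute)
  then have "x mod m = y mod m" by (simp add: mod_eq_dvd_iff)
  moreover have "x \<in> {0..<m}" "y \<in> {0..<m}" using xy assms(2) by blast+
  ultimately show "x = y" by simp
qed

text \<open>Sums of two elements of a short interval do not wrap around, so a doubling bound modulo
  \<open>m\<close> becomes one in the integers.\<close>

lemma card_set_plus_eq_nres: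
  assumes "X \<subseteq> {0..L}" "2 * L < m"
  shows "card (X + X) = nres m (X + X)"
proof -
  have "X + X \<subseteq> {0..<m}"
  proof
    fix s assume "s \<in> X + X"
    then obtain a b where "a \<in> X" "b \<in> X" "s = a + b" by (elim set_plus_elim)
    moreover have "a \<in> {0..L}" "b \<in> {0..L}" using calculation assms(1) by blast+
    ultimately show "s \<in> {0..<m}" using assms(2) by simp
  qed
  then show ?thesis by (simp add: nres_eq_card)
qed

text \<open>Otherwise the progression would have a single residue. Modulo a prime this makes
  \<open>e\<close> invertible.\<close>

lemma progression_difference_not_dvd:
  fixes B :: "int set"
  assumes B: "B \<subseteq> {0..<m}" "B \<subseteq> (\<lambda>i. c + e * i) ` I" and two: "2 \<le> card B"
  shows "\<not> m dvd e"
proof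
  assume "m dvd e"
  have "x = y" if xy: "x \<in> B" "y \<in> B" for x y
  proof -
    obtain i k where "x = c + e * i" "y = c + e * k" using xy B(2) by blast
    then have "x - y = e * (i - k)" by (simp add: algebra_simps)
    then have "x mod m = y mod m" using \<open>m dvd e\<close> by (simp add: mod_eq_dvd_iff)
    moreover have "x \<in> {0..<m}" "y \<in> {0..<m}" using xy B(1) by blast+
    ultimately show "x = y" by simp
  qed
  moreover have "finite B" using B(1) finite_subset by blast
  ultimately have "card B \<le> 1" by (simp add: card_le_Suc0_iff_eq)
  then show False using two by simp
qed

text \<open>Multiplying by the inverse \<open>f\<close> of \<open>e\<close> modulo \<open>m\<close>
  turns the progression into an interval; composed with the given affine map this is again an affine
  map.\<close>

lemma straighten_progression:
  fixes m :: int
  assumes q: "coprime q m" and m: "prime m" "\<not> m dvd e" and L: "L < m"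
    and Y: "(\<lambda>a. (q * a - z) mod m) ` Y \<subseteq> (\<lambda>i. c + e * i) ` {0..L}"
  obtains q' z' where "coprime q' m" "\<And>a. a \<in> Y \<Longrightarrow> (q' * a - z') mod m \<in> {0..L}"
proof -
  have "coprime e m" using m prime_imp_coprime[of m e] by (simp add: coprime_commute)
  then obtain f where f: "[e * f = 1] (mod m)" using cong_solve_coprime_int by blast
  have cf: "coprime f m" using f by (metis cong_imp_coprime cong_sym coprime_1_left coprime_mult_left_iff)
  have dvd: "m dvd e * f - 1" using f by (simp add: cong_iff_dvd_diff)
  have "(f * q * a - f * (z + c)) mod m \<in> {0..L}" if "a \<in> Y" for a
  proof -
    obtain i where i: "i \<in> {0..L}" "(q * a - z) mod m = c + e * i" using Y \<open>a \<in> Y\<close> by blast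
    have "m dvd (q * a - z) - (c + e * i)" using i(2) by (metis mod_eq_dvd_iff mod_mod_trivial)
    then have "m dvd f * ((q * a - z) - (c + e * i)) + (e * f - 1) * i" using dvd by (intro dvd_add) auto
    also have "\<dots> = (f * q * a - f * (z + c)) - i" by (simp add: algebra_simps)
    finally have "(f * q * a - f * (z + c)) mod m = i mod m" by (simp add: mod_eq_dvd_iff)
    then show ?thesis using i(1) L by simp
  qed
  moreover have "coprime (f * q) m" using cf q by simp
  ultimately show ?thesis using that by blast
qed

text \<open>If \<open>a + Y\<close> were disjoint from \<open>Y + Y\<close>, the sumset of \<open>A\<close> would have \<open>3 |Y| - 1\<close> elements.\<close>

lemma extend_interval:
  fixes m :: int
  assumes q: "coprime q m" and YA: "Y \<subseteq> A" "A \<subseteq> {0..<m}" "Y \<noteq> {}"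
    and L: "6 * L < m" and Y: "\<And>a. a \<in> Y \<Longrightarrow> (q * a - z) mod m \<in> {0..L}"
    and small: "nres m (A + A) + 1 < 3 * card Y" and a: "a \<in> A"
  shows "(q * a - (z - L)) mod m \<in> {0..3 * L}"
proof -
  let ?\<phi> = "\<lambda>a. (q * a - z) mod m"
  have finY: "finite Y" using YA finite_subset by (metis finite_atLeastLessThan_int)
  have m0: "0 < m" using YA by fastforce
  have Ym: "Y \<subseteq> {0..<m}" using YA by blast
  have L0: "0 \<le> L" using Y YA(3) by fastforce
  have B: "?\<phi> ` Y \<subseteq> {0..L}" using Y by blast
  have "2 * card Y \<le> card (?\<phi> ` Y + ?\<phi> ` Y) + 1"
    using card_set_plus_int_ge[of "?\<phi> ` Y" "?\<phi> ` Y"] card_image[OF inj_on_affine_residues[OF q Ym]] finY YA(3) by simp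
  also have "card (?\<phi> ` Y + ?\<phi> ` Y) = nres m (Y + Y)"
    using card_set_plus_eq_nres[OF B, of m] nres_affine_set_plus[OF q] L L0 by simp
  finally have YY: "2 * card Y \<le> nres m (Y + Y) + 1" .
  let ?S = "(\<lambda>x. x mod m) ` (Y + Y)" and ?T = "(\<lambda>x. x mod m) ` (\<lambda>y. a + y) ` Y"
  have "?S \<inter> ?T \<noteq> {}"
  proof
    assume "?S \<inter> ?T = {}"
    then have "card (?S \<union> ?T) = card ?S + card ?T" using finite_residues[OF m0] by (intro card_Un_disjoint)
    moreover have "card ?S = nres m (Y + Y)" "card ?T = card Y"
      using nres_translate[of m a Y] nres_eq_card[OF Ym] by (simp_all add: nres_def)
    moreover have "Y + Y \<subseteq> A + A" "(\<lambda>y. a + y) ` Y \<subseteq> A + A"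
      using YA a by (auto intro: set_plus_mono2[THEN subsetD] set_plus_intro)
    then have "card (?S \<union> ?T) \<le> nres m (A + A)" 
      unfolding nres_def by (intro card_mono finite_residues m0) blast
    ultimately show False using YY small by linarith
  qed
  then obtain y1 y2 y3 where y: "y1 \<in> Y" "y2 \<in> Y" "y3 \<in> Y" "(y2 + y3) mod m = (a + y1) mod m"
    by (auto elim!: set_plus_elim)
  \<comment> \<open>Modulo \<open>m\<close>, \<open>a = y2 + y3 - y1\<close>, so its image lies in
    \<open>{- L..2 * L}\<close>; the shift by \<open>L\<close> makes this
    \<open>{0..3 * L}\<close>.\<close>
  define b where "b = ?\<phi> y2 + ?\<phi> y3 - ?\<phi> y1 + L"
  have "m dvd ?\<phi> y - (q * y - z)" for y by (metis mod_eq_dvd_iff mod_mod_trivial)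
  note d = this[of y1] this[of y2] this[of y3]
  have "m dvd (y2 + y3) - (a + y1)" using y(4) by (simp only: mod_eq_dvd_iff)
  then have "m dvd (?\<phi> y1 - (q * y1 - z)) - (?\<phi> y2 - (q * y2 - z)) - (?\<phi> y3 - (q * y3 - z)) - q * ((y2 + y3) - (a + y1))"
    by (intro dvd_diff[OF dvd_diff[OF dvd_diff[OF d(1,2)] d(3)]] dvd_mult)
  also have "\<dots> = (q * a - (z - L)) - b" by (simp add: b_def algebra_simps)
  finally have "(q * a - (z - L)) mod m = b mod m" by (simp only: mod_eq_dvd_iff)
  moreover have "b \<in> {0..3 * L}" using Y[OF y(1)] Y[OF y(2)] Y[OF y(3)] by (simp add: b_def)
  ultimately show ?thesis using L L0 by simp
qed

lemma covered_by_progression_mod_prime: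
  fixes p :: nat and A :: "int set"
  assumes p: "prime p" and A: "A \<subseteq> {0..<int p}"
    and small: "real (nres (int p) (A + A)) \<le> 2.48 * real (card A) - 7"
    and sparse: "real (card A) < real p / 10 ^ 10"
  obtains q z where "coprime q (int p)"
    "\<And>a. a \<in> A \<Longrightarrow> (q * a - z) mod int p \<in> {0..int (nres (int p) (A + A)) - int (card A)}"
proof -
  define n m where "n = card A" and "m = nres (int p) (A + A)"
  have ip: "prime (int p)" using p by simp
  have p0: "0 < int p" using p prime_gt_0_nat by simp
  have mn: "25 * real m \<le> 62 * real n - 175" using small by (simp add: n_def m_def)
  have np: "10000000000 * real n < real p" using sparse by (simp add: n_def)
  have finA: "finite A" using A finite_subset by blast
  have n2: "2 < n"
  proof -
    have "0 \<le> real m" by simp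
    then have "2 < real n" using mn by simp
    then show ?thesis by simp
  qed
  have "odd p" using p np n2 prime_odd_nat by auto
  obtain d :: nat where d: "0 < d" "d < p"
    "0.75 * real n \<le> cmod (\<Sum>a\<in>A. cis (2 * pi * (real d * a / p)))"
    using exists_large_fourier_coefficient[OF p A small sparse] unfolding n_def by blast
  have "\<not> p dvd d" using d by (simp add: nat_dvd_not_less)
  then have "coprime p d" using prime_imp_coprime[OF p] by blast
  then have cd: "coprime (int d) (int p)" by (simp add: coprime_commute)
  define \<zeta> where "\<zeta> a = cis (2 * pi * (real d * real_of_int a / p))" for a :: int
  obtain w where w: "cmod w = 1" "cmod (\<Sum>a\<in>A. \<zeta> a) + real (card A) \<le> 2 * real (card {a \<in> A. 0 \<le> Re (\<zeta> a * w)})"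
    using half_plane_many[OF finA, of \<zeta>] by (auto simp: \<zeta>_def)
  define Y where "Y = {a \<in> A. 0 \<le> Re (\<zeta> a * w)}"
  have YA: "Y \<subseteq> A" by (auto simp: Y_def)
  then have Yp: "Y \<subseteq> {0..<int p}" using A by blast
  have finY: "finite Y" using YA finA finite_subset by blast
  \<comment> \<open>\<open>7/8 = (1 + 3/4) / 2\<close>.\<close>
  have Yn: "7 * real n \<le> 8 * real (card Y)" using d(3) w(2) by (simp add: Y_def \<zeta>_def n_def)
  have Yle: "card Y \<le> n" using YA finA by (simp add: n_def card_mono)
  have Y2: "2 \<le> card Y" using Yn n2 by linarith
  then have Yne: "Y \<noteq> {}" by auto
  obtain x :: int where x: "\<And>t::int. 0 \<le> cos (2 * pi * (t / p) + Arg w) \<Longrightarrow> 2 * ((t - x) mod int p) < int p"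
    using arc_subset_interval[OF \<open>odd p\<close>] by blast
  have "w \<noteq> 0" using w(1) by auto
  then have wArg: "w = cis (Arg w)" using cis_Arg[of w] w(1) by (simp add: sgn_div_norm)
  have Re: "Re (\<zeta> a * w) = cos (2 * pi * ((int d * a) / p) + Arg w)" for a
    by (subst wArg) (simp add: \<zeta>_def cis_mult)
  have half: "2 * ((int d * a - x) mod int p) < int p" if "a \<in> Y" for a
    using x[of "int d * a"] that unfolding Y_def Re by simp
  define B where "B = (\<lambda>a. (int d * a - x) mod int p) ` Y"
  have Bp: "B \<subseteq> {0..<int p}" using p0 by (auto simp: B_def)
  have BL: "B \<subseteq> {0..(int p - 1) div 2}" using half p0 by (fastforce simp: B_def)
  have finB: "finite B" using finY by (simp add: B_def)
  have cB: "card B = card Y" unfolding B_def by (intro card_image inj_on_affine_residues cd Yp)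
  have "card (B + B) = nres (int p) (B + B)" using BL by (rule card_set_plus_eq_nres) presburger
  also have "\<dots> = nres (int p) (Y + Y)" unfolding B_def by (rule nres_affine_set_plus[OF cd])
  also have "\<dots> \<le> m" unfolding m_def using YA p0 by (intro nres_mono set_plus_mono2)
  finally have "1000 * real (card (B + B)) \<le> 2835 * real (card B) - 7000" using mn Yn cB by linarith
  then have "real (card (B + B)) \<le> 2.835 * real (card B) - 7" by simp
  then obtain c e where ce: "0 < e" "B \<subseteq> (\<lambda>i. c + e * i) ` {0..85 * int (card B)}"
    using covered_by_long_progression[OF finB] Y2 cB by metis
  have e: "\<not> int p dvd e" using progression_difference_not_dvd[OF Bp ce(2)] Y2 cB by simp
  \<comment> \<open>The extension to \<open>A\<close> triples the interval, and sums of two of its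
    elements must still not wrap around: hence the 6.\<close>
  have L: "6 * (85 * int (card Y)) < int p" using Yle np n2 by linarith
  then have Lp: "85 * int (card Y) < int p" by linarith
  have "(\<lambda>a. (int d * a - x) mod int p) ` Y \<subseteq> (\<lambda>i. c + e * i) ` {0..85 * int (card Y)}"
    using ce(2) unfolding cB unfolding B_def .
  from straighten_progression[OF cd ip e Lp this]
  obtain q1 z1 where q1: "coprime q1 (int p)" "\<And>a. a \<in> Y \<Longrightarrow> (q1 * a - z1) mod int p \<in> {0..85 * int (card Y)}"
    by blast
  define L where "L = 85 * int (card Y)"
  define z2 where "z2 = z1 - L"
  \<comment> \<open>Here \<open>2.48 < 3 * 7/8 = 2.625\<close> is used.\<close>
  have "nres (int p) (A + A) + 1 < 3 * card Y" using mn Yn n2 unfolding m_def by linarith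
  then have ext: "(q1 * a - z2) mod int p \<in> {0..3 * L}" if "a \<in> A" for a
    unfolding z2_def using extend_interval[OF q1(1) YA A Yne, of L z1 a] L q1(2) that by (simp add: L_def)
  define D where "D = (\<lambda>a. (q1 * a - z2) mod int p) ` A"
  have Dp: "D \<subseteq> {0..<int p}" using p0 by (auto simp: D_def)
  have DL: "D \<subseteq> {0..3 * L}" using ext unfolding D_def by blast
  have finD: "finite D" using finA by (simp add: D_def)
  have cD: "card D = n" unfolding D_def n_def by (intro card_image inj_on_affine_residues q1 A)
  have "card (D + D) = nres (int p) (D + D)" using DL by (rule card_set_plus_eq_nres) (use L in \<open>simp add: L_def\<close>)
  also have "\<dots> = m" unfolding D_def m_def by (rule nres_affine_set_plus[OF q1(1)])
  finally have cDD: "card (D + D) = m" .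
  \<comment> \<open>All of \<open>A\<close> now lives in the integers with doubling below 5/2, so
    the sharp length bound applies.\<close>
  have "2 * card (D + D) + 3 < 5 * card D" using mn n2 unfolding cDD cD by linarith
  then obtain c' e' where ce': "0 < e'" "D \<subseteq> (\<lambda>i. c' + e' * i) ` {0..int (card (D + D)) - int (card D)}"
    using covered_by_short_progression[OF finD] n2 cD by (metis less_imp_le)
  have e': "\<not> int p dvd e'" using progression_difference_not_dvd[OF Dp ce'(2)] n2 cD by simp
  have Np: "int m - int n < int p" using mn np by linarith
  have "(\<lambda>a. (q1 * a - z2) mod int p) ` A \<subseteq> (\<lambda>i. c' + e' * i) ` {0..int m - int n}"
    using ce'(2) unfolding cD cDD unfolding D_def .
  from straighten_progression[OF q1(1) ip e' Np this]
  obtain q z where "coprime q (int p)" "\<And>a. a \<in> A \<Longrightarrow> (q * a - z) mod int p \<in> {0..int m - int n}"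
    by blast
  then show ?thesis using that unfolding m_def n_def by blast
qed

section \<open>Transfer to the ring of residues\<close>

lemma add_pow_residue_ring:
  assumes "1 < m" "0 \<le> r" "r < m"
  shows "[(k::nat)] \<cdot>\<^bsub>residue_ring m\<^esub> r = (int k * r) mod m"
proof -
  interpret residues m "residue_ring m" by unfold_locales (use assms in simp_all)
  show ?thesis
    by (induction k) (simp_all add: add.nat_pow_Suc add.nat_pow_0 res_add_eq res_zero_eq mod_simps algebra_simps)
qed

lemma set_add_residue_ring: "A <+>\<^bsub>residue_ring m\<^esub> B = (\<lambda>x. x mod m) ` (A + B)"
  by (auto simp: set_add_def' residue_ring_def set_plus_def)

theorem theorem1p1:
  fixes p :: nat and A :: "int set"
  defines "Zp \<equiv> residue_ring (int p)"
  assumes "prime p"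
    and "A \<subseteq> carrier Zp"
    and "real (card (A <+>\<^bsub>Zp\<^esub> A)) \<le> 2.48 * real (card A) - 7"
    and "real (card A) < real p / 10 ^ 10"
  shows "\<exists>P. arithmetic_progression Zp P \<and> A \<subseteq> P \<and>
           int (card P) \<le> int (card (A <+>\<^bsub>Zp\<^esub> A)) - int (card A) + 1"
proof -
  have p1: "1 < p" using \<open>prime p\<close> prime_gt_1_nat by simp
  have A: "A \<subseteq> {0..<int p}" using assms(3) by (auto simp: Zp_def residue_ring_def)
  have AA: "card (A <+>\<^bsub>Zp\<^esub> A) = nres (int p) (A + A)" by (simp add: Zp_def set_add_residue_ring nres_def)
  define N where "N = int (nres (int p) (A + A)) - int (card A)"
  obtain q z where qz: "coprime q (int p)" "\<And>a. a \<in> A \<Longrightarrow> (q * a - z) mod int p \<in> {0..N}"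
    using covered_by_progression_mod_prime[OF \<open>prime p\<close> A] assms(4,5) unfolding AA N_def by blast
  have "A \<noteq> {}" using assms(4) by auto
  then have N0: "0 \<le> N" using qz(2) by fastforce
  obtain f where f: "[q * f = 1] (mod int p)" using cong_solve_coprime_int[OF qz(1)] by blast
  have dvd: "int p dvd q * f - 1" using f by (simp add: cong_iff_dvd_diff)
  \<comment> \<open>Solving \<open>i = q * a - z\<close> for \<open>a\<close> gives
    \<open>a = f * z + i * f\<close>: first term \<open>f * z\<close>, difference \<open>f\<close>,
    and \<open>N + 1\<close> terms.\<close>
  define x r where "x = (f * z) mod int p" and "r = f mod int p"
  define k where "k = nat N + 1"
  define P where "P = (\<lambda>i::nat. x \<oplus>\<^bsub>Zp\<^esub> [i] \<cdot>\<^bsub>Zp\<^esub> r) ` {0..k - 1}"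
  have carrier: "x \<in> carrier Zp" "r \<in> carrier Zp" using p1 by (simp_all add: x_def r_def Zp_def residue_ring_def)
  have "r \<noteq> 0"
  proof
    assume "r = 0"
    then have "int p dvd q * f" by (auto simp: r_def)
    then have "int p dvd 1" using dvd by (metis dvd_diff_right_iff dvd_diff_commute)
    then show False using p1 by simp
  qed
  then have r0: "r \<noteq> \<zero>\<^bsub>Zp\<^esub>" by (simp add: Zp_def residue_ring_def)
  have "arithmetic_progression Zp P"
    unfolding arithmetic_progression_def P_def
    by (rule bexI[OF _ carrier(1)], rule bexI[OF _ carrier(2)], rule exI[of _ k]) (simp add: k_def r0)
  moreover have "A \<subseteq> P"
  proof
    fix a assume "a \<in> A"
    define i where "i = (q * a - z) mod int p"
    have i: "0 \<le> i" "i \<le> N" using qz(2)[OF \<open>a \<in> A\<close>] by (simp_all add: i_def)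
    have "int p dvd (q * a - z) - i" by (metis i_def mod_eq_dvd_iff mod_mod_trivial)
    then have "int p dvd (q * f - 1) * a - f * ((q * a - z) - i)" using dvd by (intro dvd_diff) auto
    also have "\<dots> = (f * z + i * f) - a" by (simp add: algebra_simps)
    finally have "(f * z + i * f) mod int p = a mod int p" by (simp only: mod_eq_dvd_iff)
    moreover have "a mod int p = a" using A \<open>a \<in> A\<close> by auto
    moreover have "x \<oplus>\<^bsub>Zp\<^esub> [nat i] \<cdot>\<^bsub>Zp\<^esub> r = (f * z + i * f) mod int p"
    proof -
      have "[nat i] \<cdot>\<^bsub>Zp\<^esub> r = (i * r) mod int p"
        using add_pow_residue_ring[of "int p" r "nat i"] p1 i by (simp add: Zp_def r_def)
      then show ?thesis by (simp add: Zp_def residue_ring_def x_def r_def mod_simps)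
    qed
    ultimately have "a = x \<oplus>\<^bsub>Zp\<^esub> [nat i] \<cdot>\<^bsub>Zp\<^esub> r" by simp
    then show "a \<in> P" unfolding P_def by (rule image_eqI) (use i in \<open>simp add: k_def nat_mono\<close>)
  qed
  moreover have "card P \<le> k" unfolding P_def using card_image_le[of "{0..k - 1}"] by (simp add: k_def)
  then have "int (card P) \<le> int (card (A <+>\<^bsub>Zp\<^esub> A)) - int (card A) + 1" using N0 by (simp add: AA N_def k_def)
  ultimately show ?thesis by blast
qed

end
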